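(* Let $G$ be a tight $(3,0)$-stable graph. Then $G$ has a spanning subgraph that is isomorphic to one of the following five graphs: $K_4$, $K_5$, $H_7$, $H_9$, $T_9$.
   Context: All graphs are finite and simple. For a graph $G=(V,E)$, $\alpha(G)$ denotes its independence number (the maximum size of an independent set of vertices), and for $v_1,\dots,v_k\in V$, $G\setminus\{v_1,\dots,v_k\}$ denotes the induced subgraph of $G$ on $V\setminus\{v_1,\dots,v_k\}$. For an integer $k\ge 1$, $G$ is called $(k,0)$-stable if for any $k$ vertices $v_1,\dots,v_k\in V$ we have $\alpha(G\setminus\{v_1,\dots,v_k\})\ge\alpha(G)$. A graph $G$ on $n$ vertices is called tight $(k,0)$-stable if it is $(k,0)$-stable and $\alpha(G)=\lfloor\frac{n-k+1}{2}\rfloor$. A spanning subgraph of $G$ is a subgraph (not necessarily induced) whose vertex set is all of $V$. The five graphs are as follows. $K_4$ and $K_5$ are the complete graphs on $4$ and $5$ vertices. $H_7$ has vertices $p_1,\dots,p_7$ and the $11$ edges $p_1p_2,\ p_2p_4,\ p_4p_7,\ p_7p_3,\ p_3p_1,\ p_3p_5,\ p_4p_6,\ p_7p_5,\ p_7p_6,\ p_5p_1,\ p_6p_2$. $H_9$ has vertices $q_1,q_2,q_3,r_1,r_2,r_3,s,t,u$ and the $14$ edges $q_1r_1,\ q_1r_2,\ q_2r_1,\ q_2r_2,\ q_2q_3,\ r_2r_3,\ q_3u,\ r_3u,\ su,\ tu,\ sq_3,\ tr_3,\ sq_1,\ tr_1$. $T_9$ has vertices $a,b,c,h_1,\dots,h_6$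 and the $15$ edges consisting of the hexagon $h_1h_2,\ h_2h_3,\ h_3h_4,\ h_4h_5,\ h_5h_6,\ h_6h_1$, the triangle $ab,\ bc,\ ca$, and the edges $ah_2,\ ah_5,\ bh_1,\ bh_4,\ ch_3,\ ch_6$. *)

theory Defs
  imports
    "Graph_Theory.Digraph_Isomorphism"
    "Graph_Theory.Kuratowski"
begin

text \<open>
  A finite simple graph is a graph in the sense of the locale \<^locale>\<open>graph\<close> of Graph_Theory: a finite
  symmetric digraph without loops and parallel arcs. Each undirected edge corresponds to the two
  arcs joining its end vertices, so undirected edges are counted twice in \<^const>\<open>arcs\<close>.
\<close>

definition independent_set :: "('a, 'b) pre_digraph \<Rightarrow> 'a set \<Rightarrow> bool" where
  "independent_set G S \<longleftrightarrow> S \<subseteq> verts G \<and> (\<forall>u\<in>S. \<forall>v\<in>S. (u, v) \<notin> arcs_ends G)"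

definition independence_number :: "('a, 'b) pre_digraph \<Rightarrow> nat" where
  "independence_number G = Max {card S | S. independent_set G S}"

text \<open>The vertices \<open>v\<^sub>1, \<dots>, v\<^sub>k\<close> to be deleted are taken to be distinct.\<close>

definition k0_stable :: "nat \<Rightarrow> ('a, 'b) pre_digraph \<Rightarrow> bool" where
  "k0_stable k G \<longleftrightarrow>
    (\<forall>W \<subseteq> verts G. card W = k \<longrightarrow>
      independence_number (G \<restriction> (verts G - W)) \<ge> independence_number G)"

text \<open>
  The division is on \<^typ>\<open>int\<close>, where it is the floor also if \<open>n - k + 1\<close> is negative. Truncated
  subtraction on \<^typ>\<open>nat\<close> would make the graph without vertices tight for \<open>k > 1\<close>.
\<close>

definition tight_k0_stable :: "nat \<Rightarrow> ('a, 'b) pre_digraph \<Rightarrow> bool" where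
  "tight_k0_stable k G \<longleftrightarrow>
    k0_stable k G \<and>
    int (independence_number G) = (int (card (verts G)) - int k + 1) div 2"

text \<open>In the following definition each undirected edge is listed in \<open>E\<close> in one (arbitrary) direction.\<close>

definition graph_of_edges :: "'a set \<Rightarrow> ('a \<times> 'a) set \<Rightarrow> ('a, 'a \<times> 'a) pre_digraph" where
  "graph_of_edges V E = with_proj \<lparr> pverts = V, parcs = E \<union> E\<inverse> \<rparr>"

definition complete_graph :: "nat \<Rightarrow> (nat, nat \<times> nat) pre_digraph" where
  "complete_graph n = graph_of_edges {1..n} {(i, j). 1 \<le> i \<and> i < j \<and> j \<le> n}"

datatype H7_vertex = P1 | P2 | P3 | P4 | P5 | P6 | P7

definition graph_H7 :: "(H7_vertex, H7_vertex \<times> H7_vertex) pre_digraph" where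
  "graph_H7 = graph_of_edges {P1, P2, P3, P4, P5, P6, P7}
    {(P1, P2), (P2, P4), (P4, P7), (P7, P3), (P3, P1), (P3, P5),
     (P4, P6), (P7, P5), (P7, P6), (P5, P1), (P6, P2)}"

datatype H9_vertex = Q1 | Q2 | Q3 | R1 | R2 | R3 | Vs | Vt | Vu

definition graph_H9 :: "(H9_vertex, H9_vertex \<times> H9_vertex) pre_digraph" where
  "graph_H9 = graph_of_edges {Q1, Q2, Q3, R1, R2, R3, Vs, Vt, Vu}
    {(Q1, R1), (Q1, R2), (Q2, R1), (Q2, R2), (Q2, Q3), (R2, R3), (Q3, Vu),
     (R3, Vu), (Vs, Vu), (Vt, Vu), (Vs, Q3), (Vt, R3), (Vs, Q1), (Vt, R1)}"

datatype T9_vertex = Va | Vb | Vc | H1 | H2 | H3 | H4 | H5 | H6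

definition graph_T9 :: "(T9_vertex, T9_vertex \<times> T9_vertex) pre_digraph" where
  "graph_T9 = graph_of_edges {Va, Vb, Vc, H1, H2, H3, H4, H5, H6}
    {(H1, H2), (H2, H3), (H3, H4), (H4, H5), (H5, H6), (H6, H1),
     (Va, Vb), (Vb, Vc), (Vc, Va),
     (Va, H2), (Va, H5), (Vb, H1), (Vb, H4), (Vc, H3), (Vc, H6)}"

lemma graph_graph_of_edges:
  assumes "finite V" "E \<subseteq> V \<times> V" "\<And>v. (v, v) \<notin> E"
  shows "graph (graph_of_edges V E)"
proof -
  have "finite E" using assms(1,2) by (meson finite_SigmaI finite_subset)
  then show ?thesis
    using assms
    by unfold_locales
       (auto simp: graph_of_edges_def arc_to_ends_def symmetric_def intro!: symI)
qed

lemma complete_digraph_complete_graph: "complete_digraph n (complete_graph n)"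
proof -
  have "graph (complete_graph n)"
    unfolding complete_graph_def by (rule graph_graph_of_edges) auto
  then show ?thesis
    by (auto simp: complete_digraph_def complete_graph_def graph_of_edges_def)
qed

lemma graph_H7: "graph graph_H7"
  unfolding graph_H7_def by (rule graph_graph_of_edges) auto

lemma graph_H9: "graph graph_H9"
  unfolding graph_H9_def by (rule graph_graph_of_edges) auto

lemma graph_T9: "graph graph_T9"
  unfolding graph_T9_def by (rule graph_graph_of_edges) auto

end

theory Submission
  imports Defs
begin

text \<open>
  Let \<open>n\<close> be the number of vertices and \<open>\<alpha>\<close> the independence number; tightness means that \<open>n\<close> is
  \<open>2\<alpha> + 2\<close> or \<open>2\<alpha> + 3\<close>. Deleting edges without raising \<open>\<alpha>\<close> preserves stability, so every edge may
  be taken to be critical: it is the only edge inside some set of \<open>\<alpha> + 1\<close> vertices, its witness.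
  Two facts carry the proof. First, a nonempty independent set \<open>Y\<close> satisfies \<open>|N(Y)| \<ge> |Y| + 2\<close>
  (\<open>expansion\<close>), because Hall's condition still holds after two neighbours of \<open>Y\<close> are deleted.
  Second, for witnesses of three edges \<open>va\<close>, \<open>vb\<close>, \<open>vc\<close>, the vertices that belong to at least two
  of them form an independent set, which therefore has at most \<open>\<alpha>\<close> elements. If \<open>n = 2\<alpha> + 3\<close>, then
  by counting and expansion only \<open>v\<close> is in all three and at most one vertex is in none of them
  (\<open>witness_triple\<close>).

  If \<open>n = 2\<alpha> + 2\<close>, expansion shows that even two of the witnesses meet only in \<open>v\<close>. The three
  together then have \<open>3\<alpha> + 1\<close> elements, whence \<open>\<alpha> = 1\<close> and the graph is \<open>K\<^sub>4\<close>.

  If \<open>n = 2\<alpha> + 3\<close>, all degrees are at least three and \<open>n\<close> is odd, so some vertex \<open>v\<close> has degree at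
  least four. By the second fact it has exactly four neighbours \<open>a, b, c, d\<close>, called terminals,
  and every vertex other than these five lies in exactly two of the four witnesses. This gives six
  classes \<open>P a b\<close>, \<open>P a c\<close>, and so on. All neighbours of \<open>P a b\<close> lie in \<open>P c d \<union> {c, d}\<close>, and
  \<open>|P a b| = |P c d|\<close>, so opposite classes form three balanced bipartite blocks, with sides of
  sizes \<open>x\<close>, \<open>y\<close>, \<open>z\<close> say, and \<open>\<alpha> = 1 + x + y + z\<close>. Expansion bounds the part of an independent
  set inside a block: if the set meets \<open>P a b\<close>, it has at most \<open>x\<close> elements in that block, and one
  fewer for each of \<open>c\<close>, \<open>d\<close> that it contains (\<open>indep_block_bound\<close>). With so few kinds of maximum
  independent sets, three well-chosen vertices hit all of them, which stability forbids, unless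
  one block is empty (\<open>no_three_blocks\<close>) and the others are tiny: of side one if two of them are
  nonempty, of side at most two if only one is (\<open>opposite_attachment\<close>). The sizes \<open>(0,0,0)\<close>,
  \<open>(1,0,0)\<close>, \<open>(2,0,0)\<close> and \<open>(1,1,0)\<close> that are left yield \<open>K\<^sub>5\<close>, \<open>H\<^sub>7\<close>, \<open>H\<^sub>9\<close> and \<open>T\<^sub>9\<close>.
\<close>

section \<open>Expansion of independent sets\<close>

definition indep :: "'a set \<Rightarrow> ('a \<times> 'a) set \<Rightarrow> 'a set \<Rightarrow> bool" where
  "indep V E S \<longleftrightarrow> S \<subseteq> V \<and> (\<forall>x\<in>S. \<forall>y\<in>S. (x, y) \<notin> E)"

text \<open>
  Stability of an adjacency relation, so that edges can be deleted without reference to arcs.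
  Bounding the size of \<open>D\<close> instead of fixing it gives access to smaller sets such as \<open>insert y W\<close>
  in \<open>Hall_outside\<close>.
\<close>

locale stable_relation =
  fixes V :: "'a set" and E :: "('a \<times> 'a) set" and \<alpha> :: nat
  assumes finite_V: "finite V"
    and E_subset: "E \<subseteq> V \<times> V"
    and sym_E: "(x, y) \<in> E \<Longrightarrow> (y, x) \<in> E"
    and irrefl_E: "(x, x) \<notin> E"
    and indep_bound: "indep V E S \<Longrightarrow> card S \<le> \<alpha>"
    and avoidable: "D \<subseteq> V \<Longrightarrow> card D \<le> 3 \<Longrightarrow> \<exists>S. indep V E S \<and> card S = \<alpha> \<and> S \<inter> D = {}"
begin

lemma finite_sub: "S \<subseteq> V \<Longrightarrow> finite S"
  using finite_V finite_subset by blast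

lemma neighbours_subset: "E `` Y \<subseteq> V"
  using E_subset by auto

lemma finite_neighbours: "finite (E `` Y)"
  using neighbours_subset finite_sub by blast

lemma indep_disjoint_neighbours: "indep V E S \<Longrightarrow> S \<inter> E `` S = {}"
  by (auto simp: indep_def)

text \<open>
  Hall's condition for \<open>Y\<close> in the graph without \<open>W\<close>. Pick \<open>y \<in> Y\<close> and a maximum independent set
  \<open>S\<close> that avoids \<open>W\<close> and \<open>y\<close>. Exchanging the neighbours of \<open>Y - S\<close> in \<open>S\<close> for \<open>Y - S\<close> cannot
  enlarge \<open>S\<close>, so \<open>Y - S\<close> has enough neighbours inside \<open>S\<close>. The smaller set \<open>Y \<inter> S\<close> has all its
  neighbours outside \<open>S\<close>, so the two contributions add up.
\<close>

lemma Hall_outside: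
  assumes "W \<subseteq> V" "card W \<le> 2" "indep V E Y" "Y \<inter> W = {}"
  shows "card Y \<le> card (E `` Y - W)"
  using assms(3,4)
proof (induction "card Y" arbitrary: Y rule: less_induct)
  case less
  show ?case
  proof (cases "Y = {}")
    case False
    then obtain y where y: "y \<in> Y" by blast
    have YV: "Y \<subseteq> V" using less.prems by (auto simp: indep_def)
    have finY: "finite Y" using YV finite_sub by blast
    have "card (insert y W) \<le> 3"
      using assms(1,2) finite_sub by (simp add: card_insert_if)
    then obtain S where S: "indep V E S" "card S = \<alpha>" "S \<inter> insert y W = {}"
      using avoidable[of "insert y W"] assms(1) y YV by blast
    have SV: "S \<subseteq> V" using S by (auto simp: indep_def)
    have finS: "finite S" using SV finite_sub by blast
    define Y0 where "Y0 = Y - S"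
    define Y1 where "Y1 = Y \<inter> S"
    have "indep V E ((S - E `` Y0) \<union> Y0)"
      unfolding indep_def
    proof (intro conjI ballI)
      show "S - E `` Y0 \<union> Y0 \<subseteq> V" using SV YV by (auto simp: Y0_def)
      fix x z assume "x \<in> S - E `` Y0 \<union> Y0" "z \<in> S - E `` Y0 \<union> Y0"
      then show "(x, z) \<notin> E"
        using S(1) less.prems(1) sym_E unfolding indep_def Y0_def by blast
    qed
    then have "card ((S - E `` Y0) \<union> Y0) \<le> card S"
      using indep_bound S(2) by simp
    moreover have "card ((S - E `` Y0) \<union> Y0) = card (S - E `` Y0) + card Y0"
      by (rule card_Un_disjoint) (use finS finY in \<open>auto simp: Y0_def\<close>)
    moreover have "card S = card (S - E `` Y0) + card (S \<inter> E `` Y0)"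
      using card_Int_Diff[OF finS, of "E `` Y0"] by simp
    ultimately have c0: "card Y0 \<le> card (S \<inter> E `` Y0)" by linarith
    have "Y1 \<subset> Y" using y S(3) by (auto simp: Y1_def)
    then have "card Y1 < card Y" using finY by (rule psubset_card_mono[rotated])
    then have c1: "card Y1 \<le> card (E `` Y1 - W)"
      using less.hyps[of Y1] less.prems by (auto simp: Y1_def indep_def)
    have "card (E `` Y1 - W) + card (S \<inter> E `` Y0) = card ((E `` Y1 - W) \<union> (S \<inter> E `` Y0))"
    proof (rule card_Un_disjoint[symmetric])
      show "(E `` Y1 - W) \<inter> (S \<inter> E `` Y0) = {}"
        using S(1) by (auto simp: Y1_def indep_def)
    qed (use finite_neighbours finS in auto)
    also have "\<dots> \<le> card (E `` Y - W)"
      by (rule card_mono) (use finite_neighbours S(3) in \<open>auto simp: Y0_def Y1_def\<close>)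
    finally have "card Y1 + card Y0 \<le> card (E `` Y - W)" using c0 c1 by linarith
    moreover have "card Y = card Y1 + card Y0"
      unfolding Y0_def Y1_def using card_Int_Diff[OF finY] by blast
    ultimately show ?thesis by simp
  qed simp
qed

text \<open>
  Any two neighbours of \<open>Y\<close> may be deleted and Hall's condition survives.
\<close>

lemma expansion:
  assumes "indep V E Y" "Y \<noteq> {}"
  shows "card Y + 2 \<le> card (E `` Y)"
proof -
  have finY: "finite Y" using assms(1) finite_sub by (auto simp: indep_def)
  obtain W where W: "W \<subseteq> E `` Y" "card W = min 2 (card (E `` Y))"
    using obtain_subset_with_card_n[of "min 2 (card (E `` Y))" "E `` Y"] by auto
  have "card Y \<le> card (E `` Y - W)"
    by (rule Hall_outside)
      (use W neighbours_subset indep_disjoint_neighbours[OF assms(1)] assms(1) in auto)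
  moreover have "card (E `` Y - W) = card (E `` Y) - card W"
    using W finite_neighbours by (intro card_Diff_subset) (auto intro: finite_subset)
  moreover have "0 < card Y" using finY assms(2) by (simp add: card_gt_0_iff)
  ultimately show ?thesis using W(2) by linarith
qed

lemma degree_ge_3:
  assumes "x \<in> V"
  shows "3 \<le> card (E `` {x})"
  using expansion[of "{x}"] assms irrefl_E by (simp add: indep_def)

end

section \<open>Critical edges\<close>

text \<open>
  A set of \<open>k + 1\<close> vertices in which \<open>xy\<close> is the only possible edge. Saying that removing either
  end leaves an independent set yields two independent sets of size \<open>k\<close> that differ only in \<open>x\<close>
  and \<open>y\<close>.
\<close>

definition edge_witness :: "'a set \<Rightarrow> ('a \<times> 'a) set \<Rightarrow> nat \<Rightarrow> 'a \<Rightarrow> 'a \<Rightarrow> 'a set \<Rightarrow> bool" where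
  "edge_witness V E k x y I \<longleftrightarrow> x \<noteq> y \<and> x \<in> I \<and> y \<in> I \<and> card I = Suc k \<and>
     indep V E (I - {x}) \<and> indep V E (I - {y})"

locale critical_stable_relation = stable_relation +
  assumes critical: "(x, y) \<in> E \<Longrightarrow> \<exists>I. edge_witness V E \<alpha> x y I"
begin

lemma witness_edge_unique:
  assumes "edge_witness V E \<alpha> x y I" "s \<in> I" "t \<in> I" "(s, t) \<in> E"
  shows "s = x \<and> t = y \<or> s = y \<and> t = x"
proof -
  have "s = x \<or> t = x" "s = y \<or> t = y"
    using assms unfolding edge_witness_def indep_def by blast+
  moreover have "s \<noteq> t" "x \<noteq> y"
    using assms irrefl_E unfolding edge_witness_def by blast+
  ultimately show ?thesis by blast
qed

lemma witness_subset:
  assumes "edge_witness V E \<alpha> x y I" "(x, y) \<in> E"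
  shows "I \<subseteq> V"
  using assms E_subset unfolding edge_witness_def indep_def by blast

lemma witness_other_neighbour:
  assumes "edge_witness V E \<alpha> v a I" "(v, b) \<in> E" "b \<noteq> a"
  shows "b \<notin> I"
  using witness_edge_unique[OF assms(1) _ _ assms(2)] assms irrefl_E
  unfolding edge_witness_def by blast

text \<open>
  The common part of two witnesses at \<open>v\<close>, without \<open>v\<close> itself, is an independent set with few
  neighbours, because these must avoid both witnesses.
\<close>

lemma witness_pair:
  assumes A: "edge_witness V E \<alpha> v a Ia" "(v, a) \<in> E"
    and B: "edge_witness V E \<alpha> v b Ib" "(v, b) \<in> E" and "a \<noteq> b"
  shows "indep V E (Ia \<inter> Ib)"
    and "E `` (Ia \<inter> Ib - {v}) \<subseteq> V - (Ia \<union> Ib)"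
    and "card (V - (Ia \<union> Ib)) + 2 * \<alpha> + 2 = card V + card (Ia \<inter> Ib)"
proof -
  have sub: "Ia \<subseteq> V" "Ib \<subseteq> V" using witness_subset[OF A] witness_subset[OF B] .
  have fin: "finite Ia" "finite Ib" using sub finite_sub by auto
  have a: "a \<notin> Ib" "b \<notin> Ia"
    using witness_other_neighbour A B \<open>a \<noteq> b\<close> by metis+
  show "indep V E (Ia \<inter> Ib)"
    using witness_edge_unique[OF A(1)] a sub unfolding indep_def by blast
  show "E `` (Ia \<inter> Ib - {v}) \<subseteq> V - (Ia \<union> Ib)"
    using witness_edge_unique[OF A(1)] witness_edge_unique[OF B(1)] a neighbours_subset by blast
  have "card (Ia \<union> Ib) \<le> card V" using sub finite_V by (intro card_mono) auto
  moreover have "card (V - (Ia \<union> Ib)) = card V - card (Ia \<union> Ib)"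
    using sub fin by (intro card_Diff_subset) auto
  moreover have "card (Ia \<union> Ib) + card (Ia \<inter> Ib) = card Ia + card Ib"
    using card_Un_Int fin by metis
  moreover have "card Ia = Suc \<alpha>" "card Ib = Suc \<alpha>"
    using A B unfolding edge_witness_def by auto
  ultimately show "card (V - (Ia \<union> Ib)) + 2 * \<alpha> + 2 = card V + card (Ia \<inter> Ib)" by linarith
qed

text \<open>
  With \<open>2\<alpha> + 2\<close> vertices there are too few vertices outside two witnesses for \<open>expansion\<close>, so the
  witnesses of three edges at a vertex \<open>v\<close> are disjoint apart from \<open>v\<close>.
\<close>

lemma even_order:
  assumes "card V = 2 * \<alpha> + 2"
  shows "\<alpha> \<le> 1"
proof -
  have "V \<noteq> {}" using assms by auto
  then obtain v where v: "v \<in> V" by blast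
  obtain A where A: "A \<subseteq> E `` {v}" "card A = 3"
    using obtain_subset_with_card_n[OF degree_ge_3[OF v]] by metis
  then obtain a b c where abc: "A = {a, b, c}" "a \<noteq> b" "a \<noteq> c" "b \<noteq> c"
    by (auto simp: card_3_iff)
  have e: "(v, a) \<in> E" "(v, b) \<in> E" "(v, c) \<in> E" using A(1) abc by auto
  obtain Ia Ib Ic where I: "edge_witness V E \<alpha> v a Ia" "edge_witness V E \<alpha> v b Ib"
      "edge_witness V E \<alpha> v c Ic"
    using critical e by metis
  have meet: "I \<inter> J = {v}"
    if "edge_witness V E \<alpha> v x I" "(v, x) \<in> E" "edge_witness V E \<alpha> v y J" "(v, y) \<in> E" "x \<noteq> y"
    for x y I J
  proof -
    have vI: "v \<in> I \<inter> J" using that unfolding edge_witness_def by auto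
    have fin: "finite (I \<inter> J)" using finite_sub[OF witness_subset[OF that(1,2)]] by simp
    have "card (V - (I \<union> J)) = card (I \<inter> J)"
      using witness_pair(3)[OF that] assms by linarith
    then have "card (E `` (I \<inter> J - {v})) \<le> card (I \<inter> J)"
      using witness_pair(2)[OF that] finite_V by (metis card_mono finite_Diff)
    moreover have "card (I \<inter> J) = Suc (card (I \<inter> J - {v}))"
      using card.remove[OF fin vI] by simp
    moreover have "indep V E (I \<inter> J - {v})"
      using witness_pair(1)[OF that] by (auto simp: indep_def)
    ultimately have "I \<inter> J - {v} = {}" using expansion[of "I \<inter> J - {v}"] by fastforce
    then show ?thesis using vI by blast
  qed
  have m: "Ia \<inter> Ib = {v}" "Ia \<inter> Ic = {v}" "Ib \<inter> Ic = {v}"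
    using meet[OF I(1) e(1) I(2) e(2) abc(2)] meet[OF I(1) e(1) I(3) e(3) abc(3)]
      meet[OF I(2) e(2) I(3) e(3) abc(4)] by auto
  have fin: "finite Ia" "finite Ib" "finite Ic"
    using witness_subset[OF I(1) e(1)] witness_subset[OF I(2) e(2)] witness_subset[OF I(3) e(3)]
      finite_sub by auto
  have c: "card Ia = Suc \<alpha>" "card Ib = Suc \<alpha>" "card Ic = Suc \<alpha>"
    using I unfolding edge_witness_def by auto
  have vv: "v \<in> Ia" "v \<in> Ib" "v \<in> Ic" using I unfolding edge_witness_def by auto
  have "card (Ia \<union> Ib) + card (Ia \<inter> Ib) = card Ia + card Ib" using card_Un_Int fin by metis
  moreover have "card (Ia \<union> Ib \<union> Ic) + card ((Ia \<union> Ib) \<inter> Ic) = card (Ia \<union> Ib) + card Ic"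
    using card_Un_Int fin by (metis finite_Un)
  moreover have "(Ia \<union> Ib) \<inter> Ic = {v}" using m by blast
  moreover have "card (Ia \<union> Ib \<union> Ic) \<le> card V"
    using witness_subset[OF I(1) e(1)] witness_subset[OF I(2) e(2)] witness_subset[OF I(3) e(3)]
    by (intro card_mono finite_V) auto
  ultimately show ?thesis using m(1) c assms by simp
qed

text \<open>
  The majority set \<open>M\<close> is independent: two of its elements share a witness, and the only edge of
  that witness ends in one of \<open>a\<close>, \<open>b\<close>, \<open>c\<close>, none of which is in \<open>M\<close>. Each vertex is counted by
  the three witnesses as often as by their union, by \<open>M\<close> and by the intersection \<open>P\<close> together, so
  \<open>|M| \<le> \<alpha>\<close> shows that the set \<open>Q\<close> of vertices in no witness is no larger than \<open>P\<close>. But \<open>Q\<close>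
  contains all neighbours of \<open>P - {v}\<close>, which contradicts \<open>expansion\<close> unless \<open>P = {v}\<close>.
\<close>

lemma witness_triple:
  assumes A: "edge_witness V E \<alpha> v a Ia" "(v, a) \<in> E"
    and B: "edge_witness V E \<alpha> v b Ib" "(v, b) \<in> E"
    and C: "edge_witness V E \<alpha> v c Ic" "(v, c) \<in> E"
    and ne: "a \<noteq> b" "a \<noteq> c" "b \<noteq> c" and n: "card V = 2 * \<alpha> + 3"
  shows "Ia \<inter> Ib \<inter> Ic = {v}" and "card (V - (Ia \<union> Ib \<union> Ic)) \<le> 1"
proof -
  have sub: "Ia \<subseteq> V" "Ib \<subseteq> V" "Ic \<subseteq> V"
    using witness_subset[OF A] witness_subset[OF B] witness_subset[OF C] .
  have fin: "finite Ia" "finite Ib" "finite Ic" using sub finite_sub by auto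
  have v: "v \<in> Ia" "v \<in> Ib" "v \<in> Ic" using A B C unfolding edge_witness_def by auto
  have out: "a \<notin> Ib" "a \<notin> Ic" "b \<notin> Ia" "b \<notin> Ic" "c \<notin> Ia" "c \<notin> Ib"
    using witness_other_neighbour A B C ne by metis+
  define M where "M = Ia \<inter> Ib \<union> Ia \<inter> Ic \<union> Ib \<inter> Ic"
  define P where "P = Ia \<inter> Ib \<inter> Ic"
  define Q where "Q = V - (Ia \<union> Ib \<union> Ic)"
  have "indep V E M"
    unfolding indep_def
  proof (intro conjI ballI notI)
    show "M \<subseteq> V" using sub by (auto simp: M_def)
    fix s t assume st: "s \<in> M" "t \<in> M" "(s, t) \<in> E"
    have "s \<in> Ia \<and> t \<in> Ia \<or> s \<in> Ib \<and> t \<in> Ib \<or> s \<in> Ic \<and> t \<in> Ic"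
      using st(1,2) by (auto simp: M_def)
    then have "a \<in> M \<or> b \<in> M \<or> c \<in> M"
      using witness_edge_unique[OF A(1) _ _ st(3)] witness_edge_unique[OF B(1) _ _ st(3)]
        witness_edge_unique[OF C(1) _ _ st(3)] st(1,2) by blast
    then show False using out by (auto simp: M_def)
  qed
  then have M: "card M \<le> \<alpha>" by (rule indep_bound)
  have c: "card Ia = Suc \<alpha>" "card Ib = Suc \<alpha>" "card Ic = Suc \<alpha>"
    using A B C unfolding edge_witness_def by auto
  have "card (Ia \<union> Ib) + card (Ia \<inter> Ib) = card Ia + card Ib" using card_Un_Int fin by metis
  moreover have "card (Ia \<union> Ib \<union> Ic) + card ((Ia \<union> Ib) \<inter> Ic) = card (Ia \<union> Ib) + card Ic"
    using card_Un_Int fin by (metis finite_Un)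
  moreover have "card M + card P = card (Ia \<inter> Ib) + card ((Ia \<union> Ib) \<inter> Ic)"
  proof -
    have "M = (Ia \<inter> Ib) \<union> ((Ia \<union> Ib) \<inter> Ic)" "P = (Ia \<inter> Ib) \<inter> ((Ia \<union> Ib) \<inter> Ic)"
      by (auto simp: M_def P_def)
    then show ?thesis using card_Un_Int[of "Ia \<inter> Ib" "(Ia \<union> Ib) \<inter> Ic"] fin by simp
  qed
  moreover have "card Q = card V - card (Ia \<union> Ib \<union> Ic)"
    unfolding Q_def using sub fin by (intro card_Diff_subset) auto
  ultimately have Q: "card Q \<le> card P" using M c n by linarith
  have finP: "finite P" and vP: "v \<in> P" using fin v by (auto simp: P_def)
  have "E `` (P - {v}) \<subseteq> Q"
    using witness_edge_unique[OF A(1)] witness_edge_unique[OF B(1)] witness_edge_unique[OF C(1)]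
      out neighbours_subset unfolding P_def Q_def by blast
  then have "card (E `` (P - {v})) \<le> card Q"
    using finite_V by (intro card_mono) (auto simp: Q_def)
  moreover have "card P = Suc (card (P - {v}))" using card.remove[OF finP vP] by simp
  moreover have "indep V E (P - {v})"
    using \<open>indep V E M\<close> by (auto simp: indep_def P_def M_def)
  ultimately have "P - {v} = {}" using expansion[of "P - {v}"] Q by fastforce
  then have P: "P = {v}" using vP by blast
  then show "Ia \<inter> Ib \<inter> Ic = {v}" by (simp add: P_def)
  show "card (V - (Ia \<union> Ib \<union> Ic)) \<le> 1" using Q P by (simp add: Q_def)
qed

end

section \<open>The six classes around a vertex of degree four\<close>

locale hub = critical_stable_relation +
  fixes v :: 'a and I :: "'a \<Rightarrow> 'a set"
  assumes order: "card V = 2 * \<alpha> + 3"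
    and witness: "(v, u) \<in> E \<Longrightarrow> edge_witness V E \<alpha> v u (I u)"
    and degree: "4 \<le> card (E `` {v})"
begin

definition nbrs :: "'a \<Rightarrow> 'a \<Rightarrow> 'a \<Rightarrow> 'a \<Rightarrow> bool" where
  "nbrs a b c d \<longleftrightarrow> E `` {v} = {a, b, c, d} \<and> distinct [a, b, c, d]"

definition P :: "'a \<Rightarrow> 'a \<Rightarrow> 'a set" where
  "P i j = I i \<inter> I j - {v}"

lemma nbrs_perm:
  assumes "nbrs a b c d"
  shows "nbrs b a c d" "nbrs b c d a" "nbrs b a d c" "nbrs c d a b" "nbrs a c b d" "nbrs a d b c"
  using assms by (auto simp: nbrs_def)

lemma P_commute: "P i j = P j i"
  by (auto simp: P_def)

lemma nbrs_edge:
  assumes "nbrs a b c d"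
  shows "(v, a) \<in> E" "(v, b) \<in> E" "(v, c) \<in> E" "(v, d) \<in> E"
  using assms by (auto simp: nbrs_def)

lemma v_in_V: "v \<in> V"
proof -
  have "E `` {v} \<noteq> {}" using degree by auto
  then show ?thesis using E_subset by blast
qed

lemma nbrs_in_V: "nbrs a b c d \<Longrightarrow> a \<in> V"
  using nbrs_edge(1) E_subset by blast

lemma v_in_I: "(v, u) \<in> E \<Longrightarrow> v \<in> I u"
  using witness by (auto simp: edge_witness_def)

lemma self_in_I: "(v, u) \<in> E \<Longrightarrow> u \<in> I u"
  using witness by (auto simp: edge_witness_def)

lemma other_not_in_I: "(v, u) \<in> E \<Longrightarrow> (v, w) \<in> E \<Longrightarrow> w \<noteq> u \<Longrightarrow> w \<notin> I u"
  using witness_other_neighbour witness by blast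

lemma I_subset: "(v, u) \<in> E \<Longrightarrow> I u \<subseteq> V"
  using witness witness_subset by blast

lemma P_subset:
  assumes "nbrs a b c d"
  shows "P a b \<subseteq> V"
  using I_subset[OF nbrs_edge(1)[OF assms]] by (auto simp: P_def)

lemma finite_P: "nbrs a b c d \<Longrightarrow> finite (P a b)"
  using P_subset finite_sub by blast

lemma triple:
  assumes "(v, x) \<in> E" "(v, y) \<in> E" "(v, z) \<in> E" "x \<noteq> y" "x \<noteq> z" "y \<noteq> z"
  shows "I x \<inter> I y \<inter> I z = {v}" and "card (V - (I x \<union> I y \<union> I z)) \<le> 1"
  using witness_triple[OF witness[OF assms(1)] assms(1) witness[OF assms(2)] assms(2)
      witness[OF assms(3)] assms(3) assms(4-6) order] .

lemma missed_unique:
  assumes "(v, x) \<in> E" "(v, y) \<in> E" "(v, z) \<in> E" "x \<noteq> y" "x \<noteq> z" "y \<noteq> z"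
    "s \<in> V - (I x \<union> I y \<union> I z)" "t \<in> V - (I x \<union> I y \<union> I z)"
  shows "s = t"
proof -
  have "finite (V - (I x \<union> I y \<union> I z))" using finite_V by simp
  then show ?thesis
    using triple(2)[OF assms(1-6)] assms(7,8) card_le_Suc0_iff_eq[of "V - (I x \<union> I y \<union> I z)"]
    by auto
qed

text \<open>
  A fifth neighbour would, together with the fourth, avoid the witnesses of the first three.
\<close>

lemma ex_nbrs: "\<exists>a b c d. nbrs a b c d"
proof -
  obtain A where A: "A \<subseteq> E `` {v}" "card A = 4"
    using obtain_subset_with_card_n[OF degree] by metis
  then have "card A = Suc 3" by simp
  then obtain a A1 where a: "A = insert a A1" "a \<notin> A1" "card A1 = 3"
    unfolding card_Suc_eq by blast
  then obtain b c d where bcd: "A1 = {b, c, d}" "b \<noteq> c" "b \<noteq> d" "c \<noteq> d"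
    by (auto simp: card_3_iff)
  have e: "(v, a) \<in> E" "(v, b) \<in> E" "(v, c) \<in> E" "(v, d) \<in> E" using A(1) a(1) bcd(1) by auto
  have ne: "a \<noteq> b" "a \<noteq> c" "a \<noteq> d" using a(2) bcd by auto
  have "f \<in> {a, b, c, d}" if f: "(v, f) \<in> E" for f
  proof (rule ccontr)
    assume "f \<notin> {a, b, c, d}"
    then have "f \<in> V - (I a \<union> I b \<union> I c)" "d \<in> V - (I a \<union> I b \<union> I c)"
      using other_not_in_I e f ne bcd E_subset by auto
    then show False
      using missed_unique[OF e(1-3) ne(1,2) bcd(2)] \<open>f \<notin> {a, b, c, d}\<close> by blast
  qed
  then have "nbrs a b c d" using e ne bcd by (auto simp: nbrs_def)
  then show ?thesis by blast
qed

lemma missed: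
  assumes "nbrs a b c d"
  shows "V - (I a \<union> I b \<union> I c) = {d}"
proof -
  note e = nbrs_edge[OF assms]
  have ne: "a \<noteq> b" "a \<noteq> c" "b \<noteq> c" "a \<noteq> d" "b \<noteq> d" "c \<noteq> d" using assms by (auto simp: nbrs_def)
  have "d \<in> V - (I a \<union> I b \<union> I c)"
    using other_not_in_I e ne E_subset by auto
  then show ?thesis using missed_unique[OF e(1-3) ne(1-3)] by blast
qed

lemma P_disjoint:
  assumes "nbrs a b c d"
  shows "P a b \<inter> P a c = {}" "P a b \<inter> P c d = {}"
    "v \<notin> P a b" "a \<notin> P a b" "c \<notin> P a b"
proof -
  note e = nbrs_edge[OF assms]
  have ne: "a \<noteq> b" "a \<noteq> c" "b \<noteq> c" "a \<noteq> d" "b \<noteq> d" "c \<noteq> d" using assms by (auto simp: nbrs_def)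
  show "P a b \<inter> P a c = {}" "P a b \<inter> P c d = {}"
    using triple(1)[OF e(1-3) ne(1-3)] by (auto simp: P_def)
  show "v \<notin> P a b" "a \<notin> P a b" "c \<notin> P a b"
    using other_not_in_I[OF e(2,1)] other_not_in_I[OF e(1,3)] ne by (auto simp: P_def)
qed

text \<open>
  A vertex in neither \<open>I a\<close> nor \<open>I b\<close> is in \<open>I c\<close> unless it is \<open>d\<close>, and in \<open>I d\<close> unless it is \<open>c\<close>.
\<close>

lemma outside_pair:
  assumes "nbrs a b c d"
  shows "V - (I a \<union> I b) = insert c (insert d (P c d))"
proof -
  note e = nbrs_edge[OF assms]
  have ne: "a \<noteq> b" "a \<noteq> c" "b \<noteq> c" "a \<noteq> d" "b \<noteq> d" "c \<noteq> d" using assms by (auto simp: nbrs_def)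
  have "V - (I a \<union> I b \<union> I c) = {d}" "V - (I a \<union> I b \<union> I d) = {c}"
    using missed[OF assms] missed[OF nbrs_perm(3)[OF assms]] by auto
  then have "V - (I a \<union> I b) \<subseteq> insert c (insert d (P c d))"
    using v_in_I e(1) by (auto simp: P_def)
  moreover have "insert c (insert d (P c d)) \<subseteq> V - (I a \<union> I b)"
    using I_subset[OF e(3)] triple(1)[OF e(1,3,4)] triple(1)[OF e(2,3,4)] ne
      other_not_in_I e E_subset by (auto simp: P_def)
  ultimately show ?thesis by blast
qed

lemma neighbours_P:
  assumes "nbrs a b c d"
  shows "E `` P a b \<subseteq> insert c (insert d (P c d))"
proof -
  note e = nbrs_edge[OF assms]
  have "a \<noteq> b" using assms by (auto simp: nbrs_def)
  then show ?thesis
    using witness_pair(2)[OF witness[OF e(1)] e(1) witness[OF e(2)] e(2)] outside_pair[OF assms]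
    unfolding P_def by simp
qed

text \<open>
  Both sizes are determined by \<open>|I a \<inter> I b|\<close>, since \<open>I a \<union> I b\<close> misses exactly \<open>P c d\<close>, \<open>c\<close> and
  \<open>d\<close>.
\<close>

lemma card_P_opposite:
  assumes "nbrs a b c d"
  shows "card (P c d) = card (P a b)"
proof -
  note e = nbrs_edge[OF assms]
  have ne: "a \<noteq> b" "c \<noteq> d" using assms by (auto simp: nbrs_def)
  have "card (V - (I a \<union> I b)) + 2 * \<alpha> + 2 = card V + card (I a \<inter> I b)"
    using witness_pair(3)[OF witness[OF e(1)] e(1) witness[OF e(2)] e(2) ne(1)] .
  moreover have "card (I a \<inter> I b) = Suc (card (P a b))"
    unfolding P_def using I_subset e v_in_I finite_sub
    by (metis IntI card.remove finite_Int)
  moreover have "card (V - (I a \<union> I b)) = card (P c d) + 2"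
    unfolding outside_pair[OF assms]
    using P_disjoint(4)[of c d] P_disjoint(4)[of d c] P_commute[of c d]
      nbrs_perm(4)[OF assms] nbrs_perm(3)[OF nbrs_perm(4)[OF assms]] finite_P ne
    by (simp add: card_insert_if)
  ultimately show ?thesis using order by linarith
qed

lemma indep_P:
  assumes "nbrs a b c d"
  shows "indep V E (P a b)"
proof -
  note e = nbrs_edge[OF assms]
  have "a \<noteq> b" using assms by (auto simp: nbrs_def)
  then have "indep V E (I a \<inter> I b)"
    using witness_pair(1)[OF witness[OF e(1)] e(1) witness[OF e(2)] e(2)] by simp
  then show ?thesis by (auto simp: indep_def P_def)
qed

lemma alpha_eq:
  assumes "nbrs a b c d"
  shows "\<alpha> = 1 + card (P a b) + card (P a c) + card (P a d)"
proof -
  note e = nbrs_edge[OF assms]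
  have ne: "a \<noteq> b" "a \<noteq> c" "b \<noteq> c" "a \<noteq> d" "b \<noteq> d" "c \<noteq> d" using assms by (auto simp: nbrs_def)
  have fin: "finite (P a b)" "finite (P a c)" "finite (P a d)"
    using finite_P[OF assms] finite_P[OF nbrs_perm(5)[OF assms]] finite_P[OF nbrs_perm(6)[OF assms]]
    by auto
  have "w \<in> I b \<or> w \<in> I c \<or> w \<in> I d" if "w \<in> I a" "w \<noteq> a" for w
    using missed[OF nbrs_perm(2)[OF assms]] that I_subset e(1) by blast
  then have Ia: "I a = insert v (insert a (P a b \<union> P a c \<union> P a d))"
    using v_in_I self_in_I e(1) by (auto simp: P_def)
  have dj: "P a b \<inter> P a c = {}" "(P a b \<union> P a c) \<inter> P a d = {}"
    using P_disjoint(1)[OF assms] P_disjoint(1)[OF nbrs_perm(6)[OF assms]]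
      triple(1)[OF e(1,3,4)] ne by (auto simp: P_def)
  have av: "a \<notin> P a b \<union> P a c \<union> P a d" "v \<notin> insert a (P a b \<union> P a c \<union> P a d)"
    using other_not_in_I[OF _ e(1)] e ne irrefl_E by (auto simp: P_def)
  have "card (I a) = card (P a b) + card (P a c) + card (P a d) + 2"
    unfolding Ia using dj av fin by (simp add: card_Un_disjoint)
  moreover have "card (I a) = Suc \<alpha>" using witness[OF e(1)] by (simp add: edge_witness_def)
  ultimately show ?thesis by linarith
qed

lemma V_cover:
  assumes "nbrs a b c d"
  shows "V = {v, a, b, c, d} \<union> (P a b \<union> P c d) \<union> (P b c \<union> P a d) \<union> (P a c \<union> P b d)"
proof -
  note e = nbrs_edge[OF assms]
  have "w \<in> {v, a, b, c, d} \<union> (P a b \<union> P c d) \<union> (P b c \<union> P a d) \<union> (P a c \<union> P b d)"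
    if "w \<in> V" for w
    using that missed[OF assms] missed[OF nbrs_perm(2)[OF assms]]
      missed[OF nbrs_perm(3)[OF assms]] missed[OF nbrs_perm(4)[OF assms]]
    unfolding P_def by blast
  moreover have "{v, a, b, c, d} \<union> (P a b \<union> P c d) \<union> (P b c \<union> P a d) \<union> (P a c \<union> P b d) \<subseteq> V"
    using e E_subset I_subset v_in_V unfolding P_def by blast
  ultimately show ?thesis by blast
qed

lemma card_split:
  assumes n: "nbrs a b c d" and S: "S \<subseteq> V"
  shows "card S = of_bool (v \<in> S) + of_bool (a \<in> S) + of_bool (b \<in> S) + of_bool (c \<in> S) + of_bool (d \<in> S)
    + (card (S \<inter> P a b) + card (S \<inter> P c d)) + (card (S \<inter> P b c) + card (S \<inter> P a d))
    + (card (S \<inter> P a c) + card (S \<inter> P b d))"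
proof -
  note e = nbrs_edge[OF n]
  have ne: "a \<noteq> b" "a \<noteq> c" "b \<noteq> c" "a \<noteq> d" "b \<noteq> d" "c \<noteq> d" "v \<noteq> a" "v \<noteq> b" "v \<noteq> c" "v \<noteq> d"
    using n e irrefl_E by (auto simp: nbrs_def)
  have t: "I a \<inter> I b \<inter> I c = {v}" "I a \<inter> I b \<inter> I d = {v}" "I a \<inter> I c \<inter> I d = {v}"
    "I b \<inter> I c \<inter> I d = {v}"
    using triple(1) e ne by metis+
  have i: "a \<notin> I b" "a \<notin> I c" "a \<notin> I d" "b \<notin> I a" "b \<notin> I c" "b \<notin> I d"
    "c \<notin> I a" "c \<notin> I b" "c \<notin> I d" "d \<notin> I a" "d \<notin> I b" "d \<notin> I c"
    using other_not_in_I e ne by metis+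
  have np: "{v, a, b, c, d} \<inter> P a b = {}" "{v, a, b, c, d} \<inter> P c d = {}"
    "{v, a, b, c, d} \<inter> P b c = {}" "{v, a, b, c, d} \<inter> P a d = {}"
    "{v, a, b, c, d} \<inter> P a c = {}" "{v, a, b, c, d} \<inter> P b d = {}"
    using i by (simp_all add: P_def)
  have pd: "P a b \<inter> P c d = {}" "P b c \<inter> P a d = {}" "P a c \<inter> P b d = {}"
    "(P a b \<union> P c d) \<inter> (P b c \<union> P a d) = {}" "(P a b \<union> P c d) \<inter> (P a c \<union> P b d) = {}"
    "(P b c \<union> P a d) \<inter> (P a c \<union> P b d) = {}"
    unfolding P_def using t by blast+
  have finS: "finite S" using S finite_sub by blast
  define W where "W = {v, a, b, c, d}"
  define A where "A = P a b \<union> P c d"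
  define B where "B = P b c \<union> P a d"
  define C where "C = P a c \<union> P b d"
  have disj: "W \<inter> A = {}" "W \<inter> B = {}" "W \<inter> C = {}" "A \<inter> B = {}" "A \<inter> C = {}" "B \<inter> C = {}"
    unfolding W_def A_def B_def C_def using np pd by (simp_all only: Int_Un_distrib Un_empty)
  have "S = (S \<inter> W) \<union> (S \<inter> A) \<union> (S \<inter> B) \<union> (S \<inter> C)"
    using V_cover[OF n] S unfolding W_def[symmetric] A_def[symmetric] B_def[symmetric] C_def[symmetric]
    by blast
  also have "card \<dots> = card (S \<inter> W \<union> S \<inter> A \<union> S \<inter> B) + card (S \<inter> C)"
    using finS disj by (intro card_Un_disjoint) auto
  also have "card (S \<inter> W \<union> S \<inter> A \<union> S \<inter> B) = card (S \<inter> W \<union> S \<inter> A) + card (S \<inter> B)"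
    using finS disj by (intro card_Un_disjoint) auto
  also have "card (S \<inter> W \<union> S \<inter> A) = card (S \<inter> W) + card (S \<inter> A)"
    using finS disj by (intro card_Un_disjoint) auto
  finally have "card S = card (S \<inter> W) + card (S \<inter> A) + card (S \<inter> B) + card (S \<inter> C)" .
  moreover have "card (S \<inter> A) = card (S \<inter> P a b) + card (S \<inter> P c d)"
    unfolding A_def Int_Un_distrib by (rule card_Un_disjoint) (use finS pd in auto)
  moreover have "card (S \<inter> B) = card (S \<inter> P b c) + card (S \<inter> P a d)"
    unfolding B_def Int_Un_distrib by (rule card_Un_disjoint) (use finS pd in auto)
  moreover have "card (S \<inter> C) = card (S \<inter> P a c) + card (S \<inter> P b d)"
    unfolding C_def Int_Un_distrib by (rule card_Un_disjoint) (use finS pd in auto)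
  moreover have "card (S \<inter> W) = of_bool (v \<in> S) + of_bool (a \<in> S) + of_bool (b \<in> S) + of_bool (c \<in> S) + of_bool (d \<in> S)"
    unfolding W_def using ne by (simp add: Int_insert_right card_insert_if)
  ultimately show ?thesis by simp
qed

text \<open>
  The neighbours of \<open>U\<close> lie in \<open>P c d - U'\<close> or are among \<open>c\<close>, \<open>d\<close>, and by \<open>expansion\<close> there are at
  least \<open>|U| + 2\<close> of them. So \<open>U\<close> and \<open>U'\<close> fill the block only if both \<open>c\<close> and \<open>d\<close> are neighbours
  of \<open>U\<close>, and each terminal that is not costs one element.
\<close>

lemma block_bound:
  assumes n: "nbrs a b c d" and U: "U \<subseteq> P a b" "U' \<subseteq> P c d" "U \<inter> E `` U' = {}" "U \<noteq> {}"
  shows "card U + card U' + of_bool (c \<notin> E `` U) + of_bool (d \<notin> E `` U) \<le> card (P a b)"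
proof -
  have "c \<noteq> d" using n by (auto simp: nbrs_def)
  have cd: "c \<notin> P c d" "d \<notin> P c d"
    using P_disjoint(4)[OF nbrs_perm(4)[OF n]] P_disjoint(4)[OF nbrs_perm(3)[OF nbrs_perm(4)[OF n]]]
    by (auto simp: P_commute)
  have fin: "finite (P c d)" using finite_P nbrs_perm(4)[OF n] by blast
  have "indep V E U" using indep_P[OF n] U(1) by (auto simp: indep_def)
  then have "card U + 2 \<le> card (E `` U)" using U(4) by (rule expansion)
  also have "E `` U \<subseteq> (P c d - U') \<union> ({c, d} \<inter> E `` U)"
  proof
    fix w assume w: "w \<in> E `` U"
    then obtain s where "s \<in> U" "(s, w) \<in> E" by blast
    then have "w \<notin> U'" using U(3) sym_E by blast
    moreover have "w \<in> insert c (insert d (P c d))" using neighbours_P[OF n] U(1) w by blast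
    ultimately show "w \<in> (P c d - U') \<union> ({c, d} \<inter> E `` U)" using w by blast
  qed
  then have "card (E `` U) \<le> card ((P c d - U') \<union> ({c, d} \<inter> E `` U))"
    using fin by (intro card_mono) auto
  also have "\<dots> = card (P c d - U') + card ({c, d} \<inter> E `` U)"
    using fin cd by (intro card_Un_disjoint) auto
  also have "card (P c d - U') = card (P c d) - card U'"
    using fin U(2) by (intro card_Diff_subset) (auto intro: finite_subset)
  also have "card ({c, d} \<inter> E `` U) = of_bool (c \<in> E `` U) + of_bool (d \<in> E `` U)"
    using \<open>c \<noteq> d\<close> by (simp add: Int_insert_left)
  finally have "card U + 2 \<le> card (P c d) - card U' + (of_bool (c \<in> E `` U) + of_bool (d \<in> E `` U))" .
  moreover have "card U' \<le> card (P c d)" using fin U(2) by (rule card_mono)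
  ultimately show ?thesis using card_P_opposite[OF n] by (auto simp: of_bool_def split: if_splits)
qed

lemma indep_block_bound:
  assumes n: "nbrs a b c d" and S: "indep V E S" "S \<inter> P a b \<noteq> {}"
  shows "card (S \<inter> P a b) + card (S \<inter> P c d) + of_bool (c \<in> S) + of_bool (d \<in> S) \<le> card (P a b)"
proof -
  have "card (S \<inter> P a b) + card (S \<inter> P c d) + of_bool (c \<notin> E `` (S \<inter> P a b))
      + of_bool (d \<notin> E `` (S \<inter> P a b)) \<le> card (P a b)"
    by (rule block_bound[OF n _ _ _ S(2)]) (use S(1) in \<open>auto simp: indep_def\<close>)
  moreover have "c \<in> S \<Longrightarrow> c \<notin> E `` (S \<inter> P a b)" "d \<in> S \<Longrightarrow> d \<notin> E `` (S \<inter> P a b)"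
    using S(1) by (auto simp: indep_def)
  ultimately show ?thesis by (auto simp: of_bool_def split: if_splits)
qed

end

section \<open>Arithmetic of block profiles\<close>

text \<open>
  The following lemmas are the linear arithmetic behind the later case distinctions. The numbers
  \<open>i\<close> indicate whether \<open>v\<close>, \<open>a\<close>, \<open>b\<close>, \<open>c\<close>, \<open>d\<close> belong to an independent set; \<open>u, u'\<close>, \<open>w, w'\<close> and
  \<open>t, t'\<close> count its elements in \<open>P a b\<close>, \<open>P c d\<close>, then in \<open>P b c\<close>, \<open>P a d\<close>, then in \<open>P a c\<close>,
  \<open>P b d\<close>; and \<open>x\<close>, \<open>y\<close>, \<open>z\<close> are the sizes of the sides of these blocks. The disjunctions that
  involve both counts of a block come from \<open>block_bound\<close>. A missing indicator or count is one whose
  value is already known and has been inserted.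
\<close>

lemma count_three_blocks:
  fixes x y z u u' w w' t t' i\<^sub>a i\<^sub>b i\<^sub>c i\<^sub>d :: nat
  assumes "1 + x + y + z = i\<^sub>a + i\<^sub>b + i\<^sub>c + i\<^sub>d + (u + u') + (w + w') + (t + t')"
    and "i\<^sub>a \<le> 1" "i\<^sub>b \<le> 1" "i\<^sub>c \<le> 1" "i\<^sub>d \<le> 1" "u < x" "u' < x" "0 < y" "0 < z"
    and "u = 0 \<or> u + u' + i\<^sub>c + i\<^sub>d \<le> x" "u' = 0 \<or> u + u' + i\<^sub>a + i\<^sub>b \<le> x"
    and "w = 0 \<or> w + w' + i\<^sub>a + i\<^sub>d \<le> y" "w' = 0 \<or> w + w' + i\<^sub>b + i\<^sub>c \<le> y"
    and "t = 0 \<or> t + t' + i\<^sub>b + i\<^sub>d \<le> z" "t' = 0 \<or> t + t' + i\<^sub>a + i\<^sub>c \<le> z"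
  shows "x + y + z \<le> 3"
  by (insert assms, elim disjE) linarith+

lemma count_unit_blocks:
  fixes w w' t t' i\<^sub>v i\<^sub>b i\<^sub>c i\<^sub>d :: nat
  assumes "4 = i\<^sub>v + i\<^sub>b + i\<^sub>c + i\<^sub>d + (w + w') + (t + t')"
    and "i\<^sub>v + i\<^sub>b \<le> 1" "i\<^sub>v + i\<^sub>c \<le> 1" "i\<^sub>v + i\<^sub>d \<le> 1"
    and "w = 0 \<or> w + w' + i\<^sub>d \<le> 1" "w' = 0 \<or> w + w' + i\<^sub>b + i\<^sub>c \<le> 1"
    and "t = 0 \<or> t + t' + i\<^sub>b + i\<^sub>d \<le> 1" "t' = 0 \<or> t + t' + i\<^sub>c \<le> 1"
  shows False
  by (insert assms, elim disjE) linarith+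

lemma count_witness:
  fixes x y u u' w w' i\<^sub>b i\<^sub>c i\<^sub>d :: nat
  assumes "2 + x + y = 1 + i\<^sub>b + i\<^sub>c + i\<^sub>d + (u + u') + (w + w')"
    and "i\<^sub>b \<le> 1" "i\<^sub>c \<le> 1" "i\<^sub>d \<le> 1"
    and "u = 0 \<or> u + u' + i\<^sub>c + i\<^sub>d \<le> x" "u + u' + i\<^sub>b \<le> x" "0 < u'"
    and "w = 0 \<or> w + w' + 1 + i\<^sub>d \<le> y" "w' = 0 \<or> w + w' + i\<^sub>b + i\<^sub>c \<le> y"
    and "0 < y \<or> i\<^sub>b = 0 \<and> i\<^sub>c + i\<^sub>d \<le> 1"
  shows "u' = x \<and> (y = 0 \<or> i\<^sub>d = 1) \<or> i\<^sub>b = 1 \<and> u' + 1 = x"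
proof -
  have "x \<le> u'" if "i\<^sub>b = 0" by (insert assms that, elim disjE conjE) linarith+
  moreover have "1 \<le> i\<^sub>d" if "i\<^sub>b = 0" "0 < y" by (insert assms that, elim disjE conjE) linarith+
  moreover have "x \<le> u' + 1" if "i\<^sub>b = 1" by (insert assms that, elim disjE conjE) linarith+
  ultimately show ?thesis using assms(2-4,6) by linarith
qed

lemma count_avoiding:
  fixes x y u u' w w' i\<^sub>v i\<^sub>b i\<^sub>c i\<^sub>d :: nat
  assumes "1 + x + y = i\<^sub>v + i\<^sub>b + i\<^sub>c + i\<^sub>d + (u + u') + (w + w')"
    and "i\<^sub>v + i\<^sub>b \<le> 1" "i\<^sub>v + i\<^sub>c \<le> 1" "i\<^sub>v + i\<^sub>d \<le> 1" "u < x" "2 \<le> x"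
    and "u = 0 \<or> u + u' + i\<^sub>c + i\<^sub>d \<le> x" "u' = 0 \<or> u + u' + 1 + i\<^sub>b \<le> x"
    and "w = 0 \<or> w + w' + i\<^sub>d \<le> y" "w' = 0 \<or> w + w' + i\<^sub>b + i\<^sub>c \<le> y"
    and "0 < y \<or> i\<^sub>c + i\<^sub>d \<le> 1"
  shows "u + 1 = x \<and> (i\<^sub>c = 1 \<or> y = 0 \<and> i\<^sub>d = 1)"
proof -
  have "x \<le> u + 1" by (insert assms, elim disjE) linarith+
  moreover have "1 \<le> i\<^sub>c" if "0 < y" by (insert assms that, elim disjE) linarith+
  moreover have "1 \<le> i\<^sub>c + i\<^sub>d" by (insert assms, elim disjE) linarith+
  ultimately show ?thesis using assms(2-5) by linarith
qed

section \<open>Sizes of the blocks\<close>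

context hub
begin

lemma block_cases:
  assumes "nbrs a b c d" "indep V E S"
  shows "card (S \<inter> P a b) = 0 \<or>
    card (S \<inter> P a b) + card (S \<inter> P c d) + of_bool (c \<in> S) + of_bool (d \<in> S) \<le> card (P a b)"
  using indep_block_bound[OF assms] by (metis card.empty)

lemma card_Int_P_less:
  assumes "nbrs a b c d" "u \<in> P a b" "u \<notin> S"
  shows "card (S \<inter> P a b) < card (P a b)"
  by (rule psubset_card_mono) (use finite_P assms in auto)

lemma P_nonempty_iff: "nbrs a b c d \<Longrightarrow> 0 < card (P a b) \<longleftrightarrow> P a b \<noteq> {}"
  using finite_P by (simp add: card_gt_0_iff)

lemma v_excludes:
  assumes "nbrs a b c d" "indep V E S" "v \<in> S"
  shows "a \<notin> S" "b \<notin> S" "c \<notin> S" "d \<notin> S"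
  using nbrs_edge[OF assms(1)] assms(2,3) by (auto simp: indep_def)

lemma card_P_all:
  assumes "nbrs a b c d"
  shows "card (P c d) = card (P a b)" "card (P a d) = card (P b c)" "card (P b d) = card (P a c)"
    "\<alpha> = 1 + card (P a b) + card (P b c) + card (P a c)"
  using card_P_opposite[OF assms] card_P_opposite[OF nbrs_perm(2)[OF assms]]
    card_P_opposite[OF nbrs_perm(5)[OF assms]] alpha_eq[OF assms]
  by (simp_all add: P_commute)

lemma P_empty_opposite:
  assumes "nbrs a b c d" "P a b = {}"
  shows "P c d = {}"
  using card_P_opposite[OF assms(1)] assms(2) finite_P[OF nbrs_perm(4)[OF assms(1)]] by simp

lemma avoid3:
  assumes "x \<in> V" "y \<in> V" "z \<in> V"
  obtains S where "indep V E S" "card S = \<alpha>" "x \<notin> S" "y \<notin> S" "z \<notin> S"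
proof -
  have "card {x, y, z} \<le> 3" by (simp add: card_insert_if)
  then show ?thesis using avoidable[of "{x, y, z}"] assms that by auto
qed

text \<open>
  Suppose that all three blocks are nonempty and take \<open>u \<in> P a b\<close> and \<open>p \<in> P c d\<close>. An independent
  set with \<open>v\<close> attains \<open>\<alpha>\<close> only if it fills all blocks, and one with a single terminal, say \<open>a\<close>,
  only if it contains the three classes named after \<open>a\<close>. Two or three terminals cost at least as
  many elements inside the blocks as they contribute. Hence a maximum independent set that avoids
  \<open>v\<close>, \<open>u\<close>, \<open>p\<close> must contain all four terminals, and even these suffice only if all sides have
  size one. Then \<open>u\<close> and \<open>p\<close> are a whole block, and no maximum independent set avoids \<open>a\<close>, \<open>u\<close>,
  \<open>p\<close>.
\<close>

lemma no_three_blocks: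
  assumes n: "nbrs a b c d"
  shows "P a b = {} \<or> P b c = {} \<or> P a c = {}"
proof (rule ccontr)
  assume "\<not> ?thesis"
  then have ne: "P a b \<noteq> {}" "P b c \<noteq> {}" "P a c \<noteq> {}" by auto
  have n2: "nbrs c d a b" "nbrs b c a d" "nbrs a d b c" "nbrs a c b d" "nbrs b d a c"
    using n by (auto simp: nbrs_def)
  note cards = card_P_all[OF n]
  have pos: "0 < card (P a b)" "0 < card (P b c)" "0 < card (P a c)"
    using ne P_nonempty_iff n n2 by metis+
  then have "P c d \<noteq> {}" using cards by auto
  then obtain u p where up: "u \<in> P a b" "p \<in> P c d" using ne by blast
  have upV: "u \<in> V" "p \<in> V" "v \<in> V" "a \<in> V"
    using up P_subset[OF n] P_subset[OF n2(1)] v_in_V nbrs_in_V[OF n] by auto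
  have profile:
    "card (S \<inter> P a b) = 0 \<or> card (S \<inter> P a b) + card (S \<inter> P c d) + of_bool (c \<in> S) + of_bool (d \<in> S) \<le> card (P a b)"
    "card (S \<inter> P c d) = 0 \<or> card (S \<inter> P a b) + card (S \<inter> P c d) + of_bool (a \<in> S) + of_bool (b \<in> S) \<le> card (P a b)"
    "card (S \<inter> P b c) = 0 \<or> card (S \<inter> P b c) + card (S \<inter> P a d) + of_bool (a \<in> S) + of_bool (d \<in> S) \<le> card (P b c)"
    "card (S \<inter> P a d) = 0 \<or> card (S \<inter> P b c) + card (S \<inter> P a d) + of_bool (b \<in> S) + of_bool (c \<in> S) \<le> card (P b c)"
    "card (S \<inter> P a c) = 0 \<or> card (S \<inter> P a c) + card (S \<inter> P b d) + of_bool (b \<in> S) + of_bool (d \<in> S) \<le> card (P a c)"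
    "card (S \<inter> P b d) = 0 \<or> card (S \<inter> P a c) + card (S \<inter> P b d) + of_bool (a \<in> S) + of_bool (c \<in> S) \<le> card (P a c)"
    if "indep V E S" for S
    using block_cases[OF n that] block_cases[OF n2(1) that] block_cases[OF n2(2) that]
      block_cases[OF n2(3) that] block_cases[OF n2(4) that] block_cases[OF n2(5) that] cards(1-3)
    by (simp_all add: add.commute add.left_commute)
  obtain S where S: "indep V E S" "card S = \<alpha>" "v \<notin> S" "u \<notin> S" "p \<notin> S"
    using avoid3 upV by metis
  have SV: "S \<subseteq> V" using S by (simp add: indep_def)
  have "card (P a b) + card (P b c) + card (P a c) \<le> 3"
    by (rule count_three_blocks[OF _ _ _ _ _ _ _ pos(2,3) profile[OF S(1)]])
      (use card_split[OF n SV] S(2,3) cards card_Int_P_less[OF n up(1) S(4)]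
        card_Int_P_less[OF n2(1) up(2) S(5)] in simp_all)
  then have ones: "card (P a b) = 1" "card (P b c) = 1" "card (P a c) = 1"
    using pos by linarith+
  obtain T where T: "indep V E T" "card T = \<alpha>" "a \<notin> T" "u \<notin> T" "p \<notin> T"
    using avoid3 upV by metis
  have TV: "T \<subseteq> V" using T by (simp add: indep_def)
  have empty: "card (T \<inter> P a b) = 0" "card (T \<inter> P c d) = 0"
    using card_Int_P_less[OF n up(1) T(4)] card_Int_P_less[OF n2(1) up(2) T(5)] cards ones by simp_all
  have total: "4 = of_bool (v \<in> T) + of_bool (b \<in> T) + of_bool (c \<in> T) + of_bool (d \<in> T)
      + (card (T \<inter> P b c) + card (T \<inter> P a d)) + (card (T \<inter> P a c) + card (T \<inter> P b d))"
    using card_split[OF n TV] T(2,3) cards ones empty by simp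
  show False
    by (rule count_unit_blocks[OF total])
      (use profile(3-6)[OF T(1)] T(3) ones v_excludes[OF n T(1)] in auto)
qed

lemma terminal_neighbour:
  assumes n: "nbrs a b c d" and "P a b \<noteq> {}"
  shows "\<exists>u\<in>P a b. (c, u) \<in> E"
proof -
  have "c \<in> E `` P a b"
    using block_bound[OF n, of "P a b" "{}"] assms(2) by (auto split: if_splits)
  then show ?thesis using sym_E by blast
qed

text \<open>
  Otherwise \<open>a\<close>, \<open>b\<close> and \<open>P a b\<close> would form an independent set of size \<open>\<alpha> + 1\<close>.
\<close>

lemma adjacent_if_single_block:
  assumes n: "nbrs a b c d" and empty: "P a c = {}" "P b c = {}"
  shows "(a, b) \<in> E"
proof (rule ccontr)
  assume ab: "(a, b) \<notin> E"
  have n2: "nbrs b a c d" "nbrs c d a b" "nbrs d c a b" "nbrs a b d c" using n by (auto simp: nbrs_def)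
  have ne: "a \<noteq> b" "a \<noteq> c" "a \<noteq> d" "b \<noteq> c" "b \<noteq> d" using n by (auto simp: nbrs_def)
  have out: "a \<notin> P a b" "b \<notin> P a b" "a \<notin> P c d" "b \<notin> P c d"
    using P_disjoint(4)[OF n] P_disjoint(4)[OF n2(1)] P_disjoint(5)[OF n2(2)]
      P_disjoint(5)[of c d b a] n by (auto simp: P_commute nbrs_def)
  have no: "(s, a) \<notin> E" "(s, b) \<notin> E" if "s \<in> P a b" for s
    using neighbours_P[OF n] that out ne by blast+
  have "indep V E (insert a (insert b (P a b)))"
    unfolding indep_def
  proof (intro conjI ballI)
    show "insert a (insert b (P a b)) \<subseteq> V"
      using P_subset[OF n] nbrs_in_V[OF n] nbrs_in_V[OF n2(1)] by blast
    fix s t assume "s \<in> insert a (insert b (P a b))" "t \<in> insert a (insert b (P a b))"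
    then show "(s, t) \<notin> E"
      using no ab irrefl_E sym_E indep_P[OF n] unfolding indep_def by blast
  qed
  then have "card (insert a (insert b (P a b))) \<le> \<alpha>" by (rule indep_bound)
  moreover have "card (insert a (insert b (P a b))) = card (P a b) + 2"
    using out ne finite_P[OF n] by (simp add: card_insert_if)
  moreover have "\<alpha> = 1 + card (P a b)" using card_P_all[OF n] empty by simp
  ultimately show False by simp
qed

text \<open>
  The witness \<open>J\<close> of the edge \<open>ap\<close> is analysed by counting the independent sets \<open>J - {p}\<close> and
  \<open>J - {a}\<close>. Either \<open>J\<close> contains all of \<open>P c d\<close>, and then \<open>p\<close> is the only neighbour of \<open>a\<close> there
  because \<open>ap\<close> is the only edge in \<open>J\<close>; or \<open>J\<close> contains \<open>b\<close> and misses exactly one vertex of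
  \<open>P c d\<close>, which is then the only neighbour of \<open>b\<close> in that class. In the first case \<open>J\<close> also
  contains \<open>d\<close> if a second block is nonempty, so \<open>ad\<close> cannot be an edge.
\<close>

lemma terminal_attachment:
  assumes n: "nbrs a b c d" and empty: "P a c = {}" and p: "p \<in> P c d" "(a, p) \<in> E"
  shows "E `` {a} \<inter> P c d = {p} \<and> (P b c \<noteq> {} \<longrightarrow> (a, d) \<notin> E) \<or>
    2 \<le> card (P a b) \<and> (\<exists>q. E `` {b} \<inter> P c d = {q})"
proof -
  have n2: "nbrs c d a b" "nbrs b c a d" "nbrs a d b c" "nbrs c d b a" "nbrs b a d c" "nbrs d c a b"
    using n by (auto simp: nbrs_def)
  have ne: "a \<noteq> b" "a \<noteq> c" "a \<noteq> d" "b \<noteq> c" "b \<noteq> d" using n by (auto simp: nbrs_def)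
  note cards = card_P_all[OF n]
  have empty2: "P b d = {}" using P_empty_opposite[of a c b d] n empty by (auto simp: nbrs_def)
  have p_out: "p \<notin> {v, a, b, c, d}" "p \<notin> P a b" "p \<notin> P b c" "p \<notin> P a d"
    using p(1) P_disjoint[OF n2(1)] P_disjoint[OF n2(4)] P_disjoint(4)[OF n2(6)]
      P_disjoint(1)[of c d b a] P_disjoint(1)[of d c a b] n2(4,6)
    by (auto simp: P_commute)
  obtain J where J: "edge_witness V E \<alpha> a p J" using critical p(2) by blast
  have JV: "J \<subseteq> V" using witness_subset J p(2) by blast
  have finJ: "finite J" using JV finite_sub by blast
  have in_J: "a \<in> J" "p \<in> J" "card J = Suc \<alpha>" using J by (auto simp: edge_witness_def)
  have i1: "indep V E (J - {p})" and i2: "indep V E (J - {a})"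
    using J by (auto simp: edge_witness_def)
  have aV: "(a, v) \<in> E" using nbrs_edge(1)[OF n] sym_E by blast
  have "v \<notin> J"
    using witness_edge_unique[OF J in_J(1) _ aV] p_out nbrs_edge(1)[OF n] irrefl_E by blast
  \<comment> \<open>With a single nonempty block the edges \<open>ab\<close> and \<open>cd\<close> take over the role of the second block.\<close>
  have single: "(a, b) \<in> E" "(c, d) \<in> E" if "P b c = {}"
  proof -
    show "(a, b) \<in> E" using adjacent_if_single_block[OF n empty that] .
    have "P a d = {}" using that cards(2) finite_P[OF n2(3)] by simp
    then show "(c, d) \<in> E"
      using adjacent_if_single_block[OF n2(1)] empty by (simp add: P_commute)
  qed
  have J1: "(J - {a}) \<inter> X = J \<inter> X" if "a \<notin> X" for X using that by blast
  have J2: "(J - {p}) \<inter> X = J \<inter> X" if "p \<notin> X" for X using that by blast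
  have a_out: "a \<notin> P a b" "a \<notin> P c d" "a \<notin> P b c" "a \<notin> P a d"
    using P_disjoint(4)[OF n] P_disjoint(5)[OF n2(1)] P_disjoint(5)[OF n2(2)] P_disjoint(4)[OF n2(3)]
    by auto
  have b1: "card (J \<inter> P a b) = 0 \<or> card (J \<inter> P a b) + card (J \<inter> P c d) + of_bool (c \<in> J) + of_bool (d \<in> J) \<le> card (P a b)"
    using block_cases[OF n i2] a_out ne by (simp add: J1)
  have b2: "card (J \<inter> P a b) + card (J \<inter> P c d) + of_bool (b \<in> J) \<le> card (P a b)"
    using block_cases[OF n2(1) i2] a_out ne p(1) in_J(2) finJ cards(1)
    by (auto simp: J1 card_eq_0_iff)
  have b3: "card (J \<inter> P b c) = 0 \<or> card (J \<inter> P b c) + card (J \<inter> P a d) + 1 + of_bool (d \<in> J) \<le> card (P b c)"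
    using block_cases[OF n2(2) i1] p_out in_J(1) by (auto simp: J2)
  have b4: "card (J \<inter> P a d) = 0 \<or> card (J \<inter> P b c) + card (J \<inter> P a d) + of_bool (b \<in> J) + of_bool (c \<in> J) \<le> card (P b c)"
    using block_cases[OF n2(3) i1] p_out cards(2) by (auto simp: J2)
  have total: "2 + card (P a b) + card (P b c) = 1 + of_bool (b \<in> J) + of_bool (c \<in> J) + of_bool (d \<in> J)
     + (card (J \<inter> P a b) + card (J \<inter> P c d)) + (card (J \<inter> P b c) + card (J \<inter> P a d))"
    using card_split[OF n JV] in_J \<open>v \<notin> J\<close> cards(4) empty empty2 by simp
  have pos: "0 < card (J \<inter> P c d)" using p(1) in_J(2) finJ by (auto simp: card_gt_0_iff)
  have b5: "0 < card (P b c) \<or> of_bool (b \<in> J) = (0::nat) \<and> of_bool (c \<in> J) + of_bool (d \<in> J) \<le> (1::nat)"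
  proof (cases "P b c = {}")
    case True
    have "b \<notin> J"
      using witness_edge_unique[OF J in_J(1) _ single(1)[OF True]] p_out ne by blast
    moreover have "\<not> (c \<in> J \<and> d \<in> J)"
      using witness_edge_unique[OF J _ _ single(2)[OF True]] ne by blast
    ultimately show ?thesis by auto
  qed (use P_nonempty_iff[OF n2(2)] in simp)
  have "card (J \<inter> P c d) = card (P a b) \<and> (card (P b c) = 0 \<or> of_bool (d \<in> J) = (1::nat)) \<or>
      of_bool (b \<in> J) = (1::nat) \<and> card (J \<inter> P c d) + 1 = card (P a b)"
    by (rule count_witness[OF total _ _ _ b1 b2 pos b3 b4 b5]) simp_all
  then show ?thesis
  proof
    assume "card (J \<inter> P c d) = card (P a b) \<and> (card (P b c) = 0 \<or> of_bool (d \<in> J) = (1::nat))"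
    then have all: "card (J \<inter> P c d) = card (P a b)"
      and d: "card (P b c) = 0 \<or> of_bool (d \<in> J) = (1::nat)" by auto
    have "J \<inter> P c d = P c d"
      using all cards(1) finite_P[OF n2(1)] by (intro card_subset_eq) auto
    then have "E `` {a} \<inter> P c d = {p}"
      using witness_edge_unique[OF J in_J(1)] p a_out(2) by blast
    moreover have "(a, d) \<notin> E" if "P b c \<noteq> {}"
    proof -
      have "d \<in> J" using d that P_nonempty_iff[OF n2(2)] by (auto split: if_splits)
      then show ?thesis using witness_edge_unique[OF J in_J(1)] p_out ne by blast
    qed
    ultimately show ?thesis by blast
  next
    assume "of_bool (b \<in> J) = (1::nat) \<and> card (J \<inter> P c d) + 1 = card (P a b)"
    then have b: "of_bool (b \<in> J) = (1::nat)" and most: "card (J \<inter> P c d) + 1 = card (P a b)"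
      by auto
    have "b \<in> J" using b by (cases "b \<in> J") auto
    have "card (P c d - J) = 1"
      using card_Int_Diff[OF finite_P[OF n2(1)], of J] most cards(1) by (simp add: Int_commute)
    then obtain q where q: "P c d - J = {q}" using card_1_singletonE by blast
    have "E `` {b} \<inter> P c d \<subseteq> P c d - J"
      using witness_edge_unique[OF J \<open>b \<in> J\<close>] ne p_out by blast
    then have "E `` {b} \<inter> P c d \<subseteq> {q}" using q by simp
    moreover have "E `` {b} \<inter> P c d \<noteq> {}"
      using terminal_neighbour[OF n2(4)] p(1) by blast
    ultimately have "E `` {b} \<inter> P c d = {q}" by (simp add: subset_singleton_iff)
    moreover have "2 \<le> card (P a b)" using most pos by linarith
    ultimately show ?thesis by blast
  qed
qed

text \<open>
  A maximum independent set \<open>S\<close> that avoids \<open>a\<close>, \<open>u\<close>, \<open>p\<close> has no neighbour of \<open>a\<close> in \<open>P c d\<close>, so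
  meeting \<open>P c d\<close> is more expensive for it than usual. The counting leaves only one possibility:
  \<open>S\<close> contains all of \<open>P a b\<close> except \<open>u\<close>, together with \<open>c\<close> or \<open>d\<close>, and that terminal has no other
  neighbour than \<open>u\<close> in the class. As \<open>u\<close> is arbitrary, this bounds the size of the block: by one
  if \<open>c\<close> is the only candidate, and by two otherwise.
\<close>

lemma opposite_attachment:
  assumes n: "nbrs a b c d" and empty: "P a c = {}" and big: "2 \<le> card (P a b)"
    and p: "E `` {a} \<inter> P c d = {p}" and u: "u \<in> P a b"
  shows "E `` {c} \<inter> P a b = {u} \<or> P b c = {} \<and> E `` {d} \<inter> P a b = {u}"
proof -
  have n2: "nbrs c d a b" "nbrs b c a d" "nbrs a d b c" "nbrs a b d c"
    using n by (auto simp: nbrs_def)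
  note cards = card_P_all[OF n]
  have empty2: "P b d = {}" using P_empty_opposite[of a c b d] n empty by (auto simp: nbrs_def)
  have pcd: "p \<in> P c d" using p by blast
  have "a \<in> V" "u \<in> V" "p \<in> V"
    using nbrs_in_V[OF n] P_subset[OF n] P_subset[OF n2(1)] u pcd by auto
  then obtain S where S: "indep V E S" "card S = \<alpha>" "a \<notin> S" "u \<notin> S" "p \<notin> S"
    using avoid3 by metis
  have SV: "S \<subseteq> V" using S by (simp add: indep_def)
  have b1: "card (S \<inter> P a b) = 0 \<or> card (S \<inter> P a b) + card (S \<inter> P c d) + of_bool (c \<in> S) + of_bool (d \<in> S) \<le> card (P a b)"
    using block_cases[OF n S(1)] .
  have b2: "card (S \<inter> P c d) = 0 \<or> card (S \<inter> P a b) + card (S \<inter> P c d) + 1 + of_bool (b \<in> S) \<le> card (P a b)"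
  proof (cases "S \<inter> P c d = {}")
    case False
    have "card (S \<inter> P c d) + card (S \<inter> P a b) + of_bool (a \<notin> E `` (S \<inter> P c d))
        + of_bool (b \<notin> E `` (S \<inter> P c d)) \<le> card (P c d)"
      by (rule block_bound[OF n2(1) _ _ _ False]) (use S(1) in \<open>auto simp: indep_def\<close>)
    moreover have "a \<notin> E `` (S \<inter> P c d)"
    proof
      assume "a \<in> E `` (S \<inter> P c d)"
      then obtain q where "q \<in> S" "q \<in> P c d" "(q, a) \<in> E" by blast
      then have "q \<in> E `` {a} \<inter> P c d" using sym_E by blast
      then show False using p \<open>q \<in> S\<close> S(5) by simp
    qed
    moreover have "b \<in> S \<Longrightarrow> b \<notin> E `` (S \<inter> P c d)" using S(1) by (auto simp: indep_def)
    ultimately show ?thesis using cards(1) by (auto split: if_splits)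
  qed simp
  have b3: "card (S \<inter> P b c) = 0 \<or> card (S \<inter> P b c) + card (S \<inter> P a d) + of_bool (d \<in> S) \<le> card (P b c)"
    using block_cases[OF n2(2) S(1)] S(3) by simp
  have b4: "card (S \<inter> P a d) = 0 \<or> card (S \<inter> P b c) + card (S \<inter> P a d) + of_bool (b \<in> S) + of_bool (c \<in> S) \<le> card (P b c)"
    using block_cases[OF n2(3) S(1)] cards(2) by auto
  have b5: "0 < card (P b c) \<or> of_bool (c \<in> S) + of_bool (d \<in> S) \<le> (1::nat)"
  proof (cases "P b c = {}")
    case True
    then have "P a d = {}" using cards(2) finite_P[OF n2(3)] by simp
    then have "(c, d) \<in> E"
      using adjacent_if_single_block[OF n2(1)] empty by (simp add: P_commute)
    then show ?thesis using S(1) by (auto simp: indep_def)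
  qed (use P_nonempty_iff[OF n2(2)] in simp)
  have total: "1 + card (P a b) + card (P b c) = of_bool (v \<in> S) + of_bool (b \<in> S) + of_bool (c \<in> S) + of_bool (d \<in> S)
     + (card (S \<inter> P a b) + card (S \<inter> P c d)) + (card (S \<inter> P b c) + card (S \<inter> P a d))"
    using card_split[OF n SV] S(2,3) cards(4) empty empty2 by simp
  have "card (S \<inter> P a b) + 1 = card (P a b) \<and>
      (of_bool (c \<in> S) = (1::nat) \<or> card (P b c) = 0 \<and> of_bool (d \<in> S) = (1::nat))"
    by (rule count_avoiding[OF total _ _ _ card_Int_P_less[OF n u S(4)] big b1 b2 b3 b4 b5])
      (use v_excludes[OF n S(1)] in auto)
  then have most: "card (S \<inter> P a b) + 1 = card (P a b)"
    and cd: "c \<in> S \<or> P b c = {} \<and> d \<in> S"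
    using finite_P[OF n2(2)] by (cases "c \<in> S"; cases "d \<in> S"; simp)+
  have "S \<inter> P a b = P a b - {u}"
    by (rule card_subset_eq) (use most finite_P[OF n] u S(4) in auto)
  then have only: "E `` {w} \<inter> P a b \<subseteq> {u}" if "w \<in> S" for w
    using S(1) that unfolding indep_def by blast
  have "E `` {c} \<inter> P a b \<noteq> {}" "E `` {d} \<inter> P a b \<noteq> {}"
    using terminal_neighbour[OF n] terminal_neighbour[OF n2(4)] u by blast+
  then show ?thesis using cd only by blast
qed

end

section \<open>Recognising the five graphs\<close>

text \<open>
  A copy of \<open>H\<close> on the vertex set \<open>V\<close>, not necessarily induced.
\<close>

definition hosts :: "'a set \<Rightarrow> ('a \<times> 'a) set \<Rightarrow> ('c, 'd) pre_digraph \<Rightarrow> bool" where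
  "hosts V E H \<longleftrightarrow>
    (\<exists>f. bij_betw f (verts H) V \<and> (\<forall>s t. (s, t) \<in> arcs_ends H \<longrightarrow> (f s, f t) \<in> E))"

lemma (in stable_relation) hosts_graph_of_edgesI:
  assumes "finite W" "card V = card W" "f ` W = V" "\<And>s t. (s, t) \<in> F \<Longrightarrow> (f s, f t) \<in> E"
  shows "hosts V E (graph_of_edges W F)"
proof -
  have "inj_on f W" using assms(1-3) by (intro eq_card_imp_inj_on) auto
  then show ?thesis
    using assms(3,4) sym_E unfolding hosts_def bij_betw_def graph_of_edges_def
    by (intro exI[of _ f]) auto
qed

lemma only_neighbour:
  assumes "E `` {x} \<inter> A = {p}" "q \<in> A" "q \<noteq> p"
  shows "(x, q) \<notin> E"
  using assms by (metis Image_singleton_iff IntI singletonD)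

lemma three_element_subset:
  assumes "S \<subseteq> {x, y, z}" "3 \<le> card S"
  shows "x \<in> S \<and> y \<in> S \<and> z \<in> S"
proof -
  have "card {x, y, z} \<le> card S" using assms(2) by (auto simp: card_insert_if)
  then have "S = {x, y, z}" using assms(1) by (intro card_seteq) auto
  then show ?thesis by blast
qed

lemma (in stable_relation) hosts_complete:
  assumes "\<alpha> \<le> 1" "card V = k"
  shows "hosts V E (complete_graph k)"
proof -
  obtain f where f: "bij_betw f {1..k} V"
    using ex_bij_betw_nat_finite_1[OF finite_V] assms(2) by blast
  have "(f i, f j) \<in> E" if "i \<in> {1..k}" "j \<in> {1..k}" "i \<noteq> j" for i j
  proof (rule ccontr)
    assume ij: "(f i, f j) \<notin> E"
    have V: "f i \<in> V" "f j \<in> V" using bij_betwE[OF f] that by auto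
    have ne: "f i \<noteq> f j" using bij_betw_imp_inj_on[OF f] that by (auto dest: inj_onD)
    have "(f j, f i) \<notin> E" using ij sym_E by blast
    then have "indep V E {f i, f j}" using ij V irrefl_E by (auto simp: indep_def)
    then have "card {f i, f j} \<le> \<alpha>" by (rule indep_bound)
    then show False using ne assms(1) by simp
  qed
  then show ?thesis
    using f unfolding hosts_def complete_graph_def graph_of_edges_def
    by (intro exI[of _ f]) auto
qed

context hub
begin

lemma hosts_H7:
  assumes n: "nbrs a b c d" and empty: "P a c = {}" "P b c = {}" and one: "card (P a b) = 1"
  shows "hosts V E graph_H7"
proof -
  have n2: "nbrs c d a b" "nbrs b c a d" "nbrs a c b d" using n by (auto simp: nbrs_def)
  have "P b d = {}" "P a d = {}" using P_empty_opposite n2(2,3) empty by blast+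
  obtain u where u: "P a b = {u}" using one card_1_singletonE by blast
  obtain p where p: "P c d = {p}" using one card_P_opposite[OF n] card_1_singletonE by metis
  have V: "V = {v, a, b, c, d, u, p}"
    using V_cover[OF n] empty \<open>P b d = {}\<close> \<open>P a d = {}\<close> u p by auto
  have upV: "u \<in> V" "p \<in> V" using V by auto
  have "E `` {u} \<subseteq> {c, d, p}" using neighbours_P[OF n] u p by auto
  then have Nu: "(u, c) \<in> E" "(u, d) \<in> E" "(u, p) \<in> E"
    using three_element_subset[of "E `` {u}" c d p] degree_ge_3[OF upV(1)] by auto
  have "E `` {p} \<subseteq> {a, b, u}" using neighbours_P[OF n2(1)] u p by auto
  then have Np: "(p, a) \<in> E" "(p, b) \<in> E"
    using three_element_subset[of "E `` {p}" a b u] degree_ge_3[OF upV(2)] by auto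
  have ab: "(a, b) \<in> E" using adjacent_if_single_block[OF n empty] .
  have cd: "(c, d) \<in> E"
    using adjacent_if_single_block[OF n2(1)] empty \<open>P a d = {}\<close> by (simp add: P_commute)
  define f where "f = case_H7_vertex u p c a d b v"
  show ?thesis
  proof (unfold graph_H7_def, rule hosts_graph_of_edgesI[where f = f])
    show "card V = card {P1, P2, P3, P4, P5, P6, P7}"
      using order card_P_all(4)[OF n] one empty by simp
    show "f ` {P1, P2, P3, P4, P5, P6, P7} = V" unfolding V f_def by auto
  qed (use Nu Np ab cd nbrs_edge[OF n] sym_E in \<open>auto simp: f_def\<close>)
qed

text \<open>
  By \<open>opposite_attachment\<close>, every vertex of \<open>P a b\<close> is the only neighbour there of \<open>c\<close> or of \<open>d\<close>,
  so the class consists of two vertices \<open>u\<close>, \<open>w\<close> attached to different terminals. As \<open>u\<close>, \<open>w\<close> and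
  the second vertex \<open>q\<close> of \<open>P c d\<close> have degree at least three but each misses one of the terminals
  of its block, they have all the other possible neighbours.
\<close>

lemma hosts_H9:
  assumes n: "nbrs a b c d" and empty: "P a c = {}" "P b c = {}" and two: "2 \<le> card (P a b)"
    and p: "E `` {a} \<inter> P c d = {p}"
  shows "hosts V E graph_H9"
proof -
  have n2: "nbrs c d a b" "nbrs b c a d" "nbrs a c b d" using n by (auto simp: nbrs_def)
  have "P b d = {}" "P a d = {}" using P_empty_opposite n2(2,3) empty by blast+
  have att: "E `` {c} \<inter> P a b = {u} \<or> E `` {d} \<inter> P a b = {u}" if "u \<in> P a b" for u
    using opposite_attachment[OF n empty(1) two p that] by blast
  obtain B where B: "B \<subseteq> P a b" "card B = 2" using obtain_subset_with_card_n[OF two] by metis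
  then obtain x y where xy: "x \<in> P a b" "y \<in> P a b" "x \<noteq> y" by (auto simp: card_2_iff)
  obtain u w where uw: "E `` {c} \<inter> P a b = {u}" "E `` {d} \<inter> P a b = {w}" "u \<noteq> w"
    using att[OF xy(1)] att[OF xy(2)] xy(3) by (metis singleton_inject)
  have Pab: "P a b = {u, w}" using att uw by blast
  then have "card (P c d) = 2" using card_P_opposite[OF n] uw(3) by simp
  moreover have "p \<in> P c d" using p by blast
  ultimately obtain q where q: "P c d = {p, q}" "p \<noteq> q"
    by (metis card_2_iff doubleton_eq_iff insertE singletonD)
  have V: "V = {v, a, b, c, d, u, w, p, q}"
    using V_cover[OF n] empty \<open>P b d = {}\<close> \<open>P a d = {}\<close> Pab q by auto
  have inV: "u \<in> V" "w \<in> V" "q \<in> V" using V by auto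
  have "(d, u) \<notin> E" "(c, w) \<notin> E" "(a, q) \<notin> E"
    using only_neighbour[OF uw(2), of u] only_neighbour[OF uw(1), of w] only_neighbour[OF p, of q]
      uw(3) Pab q by auto
  then have no: "(u, d) \<notin> E" "(w, c) \<notin> E" "(q, a) \<notin> E" using sym_E by blast+
  have "E `` {u} \<subseteq> {c, p, q}" "E `` {w} \<subseteq> {d, p, q}"
    using neighbours_P[OF n] Pab q no by auto
  then have Nuw: "(u, c) \<in> E" "(u, p) \<in> E" "(u, q) \<in> E" "(w, d) \<in> E" "(w, p) \<in> E" "(w, q) \<in> E"
    using three_element_subset[of "E `` {u}" c p q] three_element_subset[of "E `` {w}" d p q]
      degree_ge_3[OF inV(1)] degree_ge_3[OF inV(2)] by auto
  have "E `` {q} \<subseteq> {b, u, w}" using neighbours_P[OF n2(1)] Pab q no by auto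
  then have Nq: "(q, b) \<in> E"
    using three_element_subset[of "E `` {q}" b u w] degree_ge_3[OF inV(3)] by auto
  have ap: "(a, p) \<in> E" using p by blast
  have ab: "(a, b) \<in> E" using adjacent_if_single_block[OF n empty] .
  have cd: "(c, d) \<in> E"
    using adjacent_if_single_block[OF n2(1)] empty \<open>P a d = {}\<close> by (simp add: P_commute)
  define f where "f = case_H9_vertex p q b u w d a c v"
  show ?thesis
  proof (unfold graph_H9_def, rule hosts_graph_of_edgesI[where f = f])
    show "card V = card {Q1, Q2, Q3, R1, R2, R3, Vs, Vt, Vu}"
      using order card_P_all(4)[OF n] Pab uw(3) empty by simp
    show "f ` {Q1, Q2, Q3, R1, R2, R3, Vs, Vt, Vu} = V" unfolding V f_def by auto
  qed (use Nuw Nq ap ab cd nbrs_edge[OF n] sym_E in \<open>auto simp: f_def\<close>)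
qed

lemma hosts_single_block:
  assumes n: "nbrs a b c d" and empty: "P a c = {}" "P b c = {}" and ne: "P a b \<noteq> {}"
  shows "hosts V E graph_H7 \<or>
    hosts V E graph_H9"
proof (cases "card (P a b) = 1")
  case False
  have n2: "nbrs c d a b" "nbrs b a d c" "nbrs a c b d" "nbrs b c a d" using n by (auto simp: nbrs_def)
  have empty2: "P b d = {}" "P a d = {}" using P_empty_opposite n2(3,4) empty by blast+
  have two: "2 \<le> card (P a b)" using False ne P_nonempty_iff[OF n] by linarith
  have "P c d \<noteq> {}" using P_empty_opposite[OF n2(1)] ne by blast
  then obtain p where p: "p \<in> P c d" "(a, p) \<in> E" using terminal_neighbour[OF n2(1)] by blast
  from terminal_attachment[OF n empty(1) p]
  consider "E `` {a} \<inter> P c d = {p}" | q where "E `` {b} \<inter> P c d = {q}" by blast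
  then show ?thesis
  proof cases
    case 1
    then show ?thesis using hosts_H9[OF n empty two] by blast
  next
    case 2
    then show ?thesis
      using hosts_H9[OF n2(2)] empty2 two by (simp add: P_commute)
  qed
qed (use hosts_H7[OF n empty] in blast)

text \<open>
  If another block is nonempty, \<open>opposite_attachment\<close> makes every vertex of \<open>P a b\<close> the only
  neighbour of one and the same terminal in that class.
\<close>

lemma two_blocks_unit:
  assumes n: "nbrs a b c d" and empty: "P a c = {}" and ne: "P a b \<noteq> {}" "P b c \<noteq> {}"
  shows "card (P a b) = 1"
proof (rule ccontr)
  assume "card (P a b) \<noteq> 1"
  then have two: "2 \<le> card (P a b)" using ne P_nonempty_iff[OF n] by linarith
  have n2: "nbrs c d a b" "nbrs b a d c" "nbrs a c b d" "nbrs a d b c" using n by (auto simp: nbrs_def)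
  have empty2: "P b d = {}" using P_empty_opposite n2(3) empty by blast
  have ne2: "P c d \<noteq> {}" "P a d \<noteq> {}" using P_empty_opposite n2(1,4) ne by blast+
  obtain B where B: "B \<subseteq> P a b" "card B = 2" using obtain_subset_with_card_n[OF two] by metis
  then obtain x y where xy: "x \<in> P a b" "y \<in> P a b" "x \<noteq> y" by (auto simp: card_2_iff)
  obtain p where p: "p \<in> P c d" "(a, p) \<in> E" using terminal_neighbour[OF n2(1) ne2(1)] by blast
  from terminal_attachment[OF n empty p]
  consider "E `` {a} \<inter> P c d = {p}" | q where "E `` {b} \<inter> P c d = {q}" by blast
  then show False
  proof cases
    case 1
    then have "E `` {c} \<inter> P a b = {z}" if "z \<in> P a b" for z
      using opposite_attachment[OF n empty two _ that] ne by blast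
    then show False using xy by (metis singleton_inject)
  next
    case 2
    then have "E `` {d} \<inter> P a b = {z}" if "z \<in> P a b" for z
      using opposite_attachment[OF n2(2), of q z] that two empty2 ne2 by (simp add: P_commute)
    then show False using xy by (metis singleton_inject)
  qed
qed

lemma two_blocks_nonadjacent:
  assumes n: "nbrs a b c d" and empty: "P a c = {}" and ne: "P a b \<noteq> {}" "P b c \<noteq> {}"
  shows "(a, d) \<notin> E"
proof -
  have n2: "nbrs c d a b" using n by (auto simp: nbrs_def)
  have "P c d \<noteq> {}" using P_empty_opposite n2 ne by blast
  then obtain p where p: "p \<in> P c d" "(a, p) \<in> E" using terminal_neighbour[OF n2] by blast
  then show ?thesis
    using terminal_attachment[OF n empty p] two_blocks_unit[OF assms] ne by auto
qed

lemma hosts_T9_if_adjacent: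
  assumes n: "nbrs a b c d" and empty: "P a c = {}" and ne: "P a b \<noteq> {}" "P b c \<noteq> {}"
    and bd: "(b, d) \<in> E"
  shows "hosts V E graph_T9"
proof -
  have n2: "nbrs c d a b" "nbrs b c d a" "nbrs a c b d" "nbrs a d b c" "nbrs b c a d"
    using n by (auto simp: nbrs_def)
  have empty2: "P b d = {}" using P_empty_opposite n2(3) empty by blast
  have ne2: "P c d \<noteq> {}" using P_empty_opposite n2(1) ne by blast
  have one: "card (P a b) = 1" "card (P b c) = 1"
    using two_blocks_unit[OF n empty ne] two_blocks_unit[OF n2(2) empty2 ne(2) ne2] by auto
  then have one2: "card (P c d) = 1" "card (P a d) = 1" using card_P_all[OF n] by auto
  obtain u p w x where c: "P a b = {u}" "P c d = {p}" "P b c = {w}" "P a d = {x}"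
    using one one2 by (metis card_1_singletonE)
  have V: "V = {v, a, b, c, d, u, p, w, x}" using V_cover[OF n] empty empty2 c by auto
  have inV: "u \<in> V" "p \<in> V" "w \<in> V" "x \<in> V" using V by auto
  have "E `` {u} \<subseteq> {c, d, p}" "E `` {p} \<subseteq> {a, b, u}" "E `` {w} \<subseteq> {a, d, x}" "E `` {x} \<subseteq> {b, c, w}"
    using neighbours_P[OF n] neighbours_P[OF n2(1)] neighbours_P[OF n2(5)] neighbours_P[OF n2(4)] c
    by auto
  then have N: "(u, c) \<in> E" "(u, d) \<in> E" "(u, p) \<in> E" "(p, a) \<in> E" "(p, b) \<in> E"
    "(w, a) \<in> E" "(w, d) \<in> E" "(w, x) \<in> E" "(x, b) \<in> E" "(x, c) \<in> E"
    using three_element_subset[of "E `` {u}" c d p] three_element_subset[of "E `` {p}" a b u]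
      three_element_subset[of "E `` {w}" a d x] three_element_subset[of "E `` {x}" b c w]
      degree_ge_3[OF inV(1)] degree_ge_3[OF inV(2)] degree_ge_3[OF inV(3)] degree_ge_3[OF inV(4)]
    by auto
  define f where "f = case_T9_vertex v b d p a w x c u"
  show ?thesis
  proof (unfold graph_T9_def, rule hosts_graph_of_edgesI[where f = f])
    show "card V = card {Va, Vb, Vc, H1, H2, H3, H4, H5, H6}"
      using order card_P_all(4)[OF n] one empty by simp
    show "f ` {Va, Vb, Vc, H1, H2, H3, H4, H5, H6} = V" unfolding V f_def by auto
  qed (use N bd nbrs_edge[OF n] sym_E in \<open>auto simp: f_def\<close>)
qed

text \<open>
  No two terminals that are named together by a nonempty class are adjacent. As \<open>\<alpha> = 3\<close>, the four
  terminals are not independent, so \<open>ac\<close> or \<open>bd\<close> is an edge. The two cases differ by a rotation of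
  \<open>a, b, c, d\<close>.
\<close>

lemma hosts_T9:
  assumes n: "nbrs a b c d" and empty: "P a c = {}" and ne: "P a b \<noteq> {}" "P b c \<noteq> {}"
  shows "hosts V E graph_T9"
proof -
  have n2: "nbrs b c d a" "nbrs c d a b" "nbrs d a b c" "nbrs a c b d" "nbrs a d b c"
    using n by (auto simp: nbrs_def)
  have empty2: "P b d = {}" using P_empty_opposite n2(4) empty by blast
  have ne2: "P c d \<noteq> {}" "P a d \<noteq> {}" using P_empty_opposite n2(2,5) ne by blast+
  have non: "(a, d) \<notin> E" "(b, a) \<notin> E" "(c, b) \<notin> E" "(d, c) \<notin> E"
    using two_blocks_nonadjacent[OF n] two_blocks_nonadjacent[OF n2(1)]
      two_blocks_nonadjacent[OF n2(2)] two_blocks_nonadjacent[OF n2(3)] empty empty2 ne ne2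
    by (auto simp: P_commute)
  have "(b, d) \<in> E \<or> (a, c) \<in> E"
  proof (rule ccontr)
    assume "\<not> ?thesis"
    then have "indep V E {a, b, c, d}"
      using non irrefl_E sym_E nbrs_in_V[OF n] nbrs_in_V[OF n2(1)] nbrs_in_V[OF n2(2)]
        nbrs_in_V[OF n2(3)] unfolding indep_def by blast
    then have "card {a, b, c, d} \<le> \<alpha>" by (rule indep_bound)
    moreover have "card {a, b, c, d} = 4" using n by (auto simp: nbrs_def)
    moreover have "card (P b c) = 1" using two_blocks_unit[OF n2(1) empty2 ne(2) ne2(1)] .
    ultimately show False
      using card_P_all(4)[OF n] two_blocks_unit[OF assms] empty by simp
  qed
  then show ?thesis
  proof
    assume "(a, c) \<in> E"
    then have "(c, a) \<in> E" by (rule sym_E)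
    then show ?thesis using hosts_T9_if_adjacent[OF n2(1) empty2 ne(2) ne2(1)] by blast
  qed (rule hosts_T9_if_adjacent[OF n empty ne])
qed

text \<open>
  By \<open>no_three_blocks\<close> the neighbours of \<open>v\<close> can be named so that the block of \<open>P a c\<close> is empty.
\<close>

lemma hosts_odd:
  "hosts V E (complete_graph 5) \<or>
   hosts V E graph_H7 \<or>
   hosts V E graph_H9 \<or>
   hosts V E graph_T9"
proof -
  obtain a b c d where "nbrs a b c d" using ex_nbrs by blast
  then have "\<exists>a b c d. nbrs a b c d \<and> P a c = {}"
    using no_three_blocks[of a b c d] nbrs_perm(1)[of a b c d] nbrs_perm(5)[of a b c d] by blast
  then obtain a b c d where n: "nbrs a b c d" and empty: "P a c = {}" by blast
  have n2: "nbrs b c d a" "nbrs a c b d" using n by (auto simp: nbrs_def)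
  have empty2: "P b d = {}" using P_empty_opposite n2(2) empty by blast
  consider "P a b = {}" "P b c = {}" | "P a b \<noteq> {}" "P b c = {}"
    | "P a b = {}" "P b c \<noteq> {}" | "P a b \<noteq> {}" "P b c \<noteq> {}" by blast
  then show ?thesis
  proof cases
    case 1
    then have "\<alpha> = 1" using card_P_all(4)[OF n] empty by simp
    then show ?thesis using hosts_complete[of 5] order by auto
  next
    case 2
    then show ?thesis using hosts_single_block[OF n empty] by blast
  next
    case 3
    then have "P c d = {}" using P_empty_opposite n by blast
    then show ?thesis using hosts_single_block[OF n2(1) empty2] 3 by blast
  next
    case 4
    then show ?thesis using hosts_T9[OF n empty] by blast
  qed
qed

end

section \<open>Reduction to critical relations\<close>

lemma even_card_symmetric:
  assumes "finite R" "\<And>x y. (x, y) \<in> R \<Longrightarrow> (y, x) \<in> R" "\<And>x. (x, x) \<notin> R"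
  shows "even (card R)"
  using assms
proof (induction "card R" arbitrary: R rule: less_induct)
  case less
  show ?case
  proof (cases "R = {}")
    case False
    then obtain x y where xy: "(x, y) \<in> R" by auto
    then have yx: "(y, x) \<in> R" and ne: "x \<noteq> y" using less.prems by blast+
    have "card R = card (R - {(x, y), (y, x)}) + 2"
      using card_Diff_subset[of "{(x, y), (y, x)}" R] xy yx ne less.prems(1)
        card_mono[of R "{(x, y), (y, x)}"] by simp
    moreover from this have "even (card (R - {(x, y), (y, x)}))"
      by (intro less.hyps) (use less.prems in auto)
    ultimately show ?thesis by simp
  qed simp
qed

lemma (in stable_relation) ex_degree_ge_4:
  assumes "odd (card V)"
  shows "\<exists>v. 4 \<le> card (E `` {v})"
proof (rule ccontr)
  assume "\<not> ?thesis"
  then have "\<not> 4 \<le> card (E `` {x})" for x by blast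
  then have deg: "card (E `` {x}) = 3" if "x \<in> V" for x
    using degree_ge_3[OF that] by (simp add: not_le le_antisym less_Suc_eq_le numeral_eq_Suc)
  have "E = Sigma V (\<lambda>x. E `` {x})" using E_subset by blast
  then have "card E = (\<Sum>x\<in>V. card (E `` {x}))"
    using card_SigmaI[OF finite_V, of "\<lambda>x. E `` {x}"] finite_neighbours by simp
  also have "\<dots> = 3 * card V" using deg by simp
  finally have "card E = 3 * card V" .
  moreover have "even (card E)"
    using even_card_symmetric[of E] sym_E irrefl_E E_subset finite_V
    by (meson finite_SigmaI finite_subset)
  ultimately show False using assms by simp
qed

text \<open>
  A symmetric subrelation with the fewest edges among those in which independent sets still have
  at most \<open>\<alpha>\<close> elements. Fewer edges leave more independent sets, so stability is inherited.
\<close>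

lemma (in stable_relation) ex_critical:
  "\<exists>F\<subseteq>E. critical_stable_relation V F \<alpha>"
proof -
  define Q where "Q F \<longleftrightarrow> F \<subseteq> E \<and> (\<forall>x y. (x, y) \<in> F \<longrightarrow> (y, x) \<in> F) \<and>
    (\<forall>S. indep V F S \<longrightarrow> card S \<le> \<alpha>)" for F
  have "Q E" using sym_E indep_bound by (auto simp: Q_def)
  then obtain F where F: "Q F" "\<And>F'. Q F' \<Longrightarrow> card F \<le> card F'"
    using ex_has_least_nat[of Q E card] by blast
  have FE: "F \<subseteq> E" and symF: "\<And>x y. (x, y) \<in> F \<Longrightarrow> (y, x) \<in> F"
    and boundF: "\<And>S. indep V F S \<Longrightarrow> card S \<le> \<alpha>" using F(1) by (auto simp: Q_def)
  have finF: "finite F" using FE E_subset finite_V by (meson finite_SigmaI finite_subset)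
  have "critical_stable_relation V F \<alpha>"
  proof unfold_locales
    show "finite V" "F \<subseteq> V \<times> V" using finite_V FE E_subset by auto
    show "(y, x) \<in> F" if "(x, y) \<in> F" for x y using symF that .
    show "(x, x) \<notin> F" for x using FE irrefl_E by blast
    show "card S \<le> \<alpha>" if "indep V F S" for S using boundF that .
    show "\<exists>S. indep V F S \<and> card S = \<alpha> \<and> S \<inter> D = {}" if D: "D \<subseteq> V" "card D \<le> 3" for D
    proof -
      obtain S where "indep V E S" "card S = \<alpha>" "S \<inter> D = {}" using avoidable[OF D] by blast
      moreover have "indep V F S" using \<open>indep V E S\<close> FE by (auto simp: indep_def)
      ultimately show ?thesis by blast
    qed
    fix x y assume xy: "(x, y) \<in> F"
    define F' where "F' = F - {(x, y), (y, x)}"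
    have "card F' < card F" using xy finF unfolding F'_def by (intro psubset_card_mono) auto
    then have "\<not> Q F'" using F(2)[of F'] by linarith
    then obtain S where S: "indep V F' S" "\<not> card S \<le> \<alpha>"
      using FE symF unfolding Q_def F'_def by blast
    have "x \<noteq> y" using xy FE irrefl_E by blast
    have ix: "indep V F (S - {x})" and iy: "indep V F (S - {y})"
      using S(1) by (auto simp: indep_def F'_def)
    have "x \<in> S"
    proof (rule ccontr)
      assume "x \<notin> S"
      then show False using boundF[OF ix] S(2) by simp
    qed
    moreover have "y \<in> S"
    proof (rule ccontr)
      assume "y \<notin> S"
      then show False using boundF[OF iy] S(2) by simp
    qed
    moreover have "card S = Suc \<alpha>"
    proof -
      have "finite S" using S(1) finite_sub by (auto simp: indep_def)
      then have "card S = Suc (card (S - {x}))" using \<open>x \<in> S\<close> card.remove by metis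
      then show ?thesis using boundF[OF ix] S(2) by linarith
    qed
    ultimately show "\<exists>I. edge_witness V F \<alpha> x y I"
      using ix iy \<open>x \<noteq> y\<close> unfolding edge_witness_def by blast
  qed
  then show ?thesis using FE by blast
qed

section \<open>From relations back to graphs\<close>

text \<open>
  The arcs of \<open>H\<close> are those arcs of \<open>G\<close> whose ends are mapped to an edge of the model by the
  inverse \<open>g\<close> of the embedding.
\<close>

lemma spanning_copy:
  fixes G :: "('a, 'b) pre_digraph" and W :: "'c set"
  assumes G: "graph G" and host: "hosts (verts G) E (graph_of_edges W F)"
    and E: "E \<subseteq> arcs_ends G" and F: "F \<subseteq> W \<times> W"
  shows "\<exists>H. spanning H G \<and> digraph_iso H (graph_of_edges W F)"
proof -
  interpret graph G by fact
  obtain f where f: "bij_betw f W (verts G)"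
    and fE: "\<And>s t. (s, t) \<in> F \<union> F\<inverse> \<Longrightarrow> (f s, f t) \<in> E"
    using host unfolding hosts_def graph_of_edges_def by auto
  define g where "g = the_inv_into W f"
  have g: "bij_betw g (verts G) W" unfolding g_def using f by (rule bij_betw_the_inv_into)
  have gf: "g (f s) = s" if "s \<in> W" for s
    unfolding g_def using f that by (auto simp: bij_betw_def the_inv_into_f_f)
  define A where "A = {e \<in> arcs G. (g (tail G e), g (head G e)) \<in> F \<union> F\<inverse>}"
  define H where "H = G\<lparr>arcs := A\<rparr>"
  have H: "verts H = verts G" "arcs H = A" "tail H = tail G" "head H = head G"
    by (simp_all add: H_def)
  have wfH: "wf_digraph H"
    by unfold_locales (auto simp: H A_def)
  have span: "spanning H G"
    using wfH wf_digraph by (auto simp: spanning_def subgraph_def compatible_def H A_def)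
  define h where "h = \<lparr>iso_verts = g, iso_arcs = \<lambda>e. (g (tail G e), g (head G e)),
    iso_head = snd, iso_tail = fst\<rparr>"
  have "inj_on (\<lambda>e. (g (tail G e), g (head G e))) A"
  proof (rule inj_onI)
    fix e e' assume e: "e \<in> A" "e' \<in> A" "(g (tail G e), g (head G e)) = (g (tail G e'), g (head G e'))"
    then have "tail G e = tail G e'" "head G e = head G e'"
      using g unfolding bij_betw_def inj_on_def A_def by auto
    then show "e = e'" using no_multi_arcs e(1,2) by (auto simp: A_def arc_to_ends_def)
  qed
  then have "pre_digraph.digraph_isomorphism H h"
    using wfH g unfolding pre_digraph.digraph_isomorphism_def by (auto simp: h_def H bij_betw_def)
  moreover have "graph_of_edges W F = app_iso h H"
  proof -
    have "(\<lambda>e. (g (tail G e), g (head G e))) ` A = F \<union> F\<inverse>"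
    proof
      show "F \<union> F\<inverse> \<subseteq> (\<lambda>e. (g (tail G e), g (head G e))) ` A"
      proof (rule subrelI)
        fix s t assume st: "(s, t) \<in> F \<union> F\<inverse>"
        have "(f s, f t) \<in> arcs_ends G"
          using fE[OF st] E by blast
        then obtain e where e: "e \<in> arcs G" "tail G e = f s" "head G e = f t"
          by (auto simp: arcs_ends_conv)
        have "s \<in> W" "t \<in> W" using st F by auto
        then have "(g (tail G e), g (head G e)) = (s, t)" using e gf by simp
        then show "(s, t) \<in> (\<lambda>e. (g (tail G e), g (head G e))) ` A"
          using e(1) st unfolding A_def by (metis (mono_tags, lifting) image_eqI mem_Collect_eq)
      qed
    qed (auto simp: A_def)
    moreover have "g ` verts G = W" using g by (simp add: bij_betw_def)
    ultimately show ?thesis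
      by (simp add: app_iso_def h_def H graph_of_edges_def with_proj_def)
  qed
  ultimately have "digraph_iso H (graph_of_edges W F)" unfolding digraph_iso_def by blast
  then show ?thesis using span by blast
qed

lemma independence_number_props:
  assumes "finite (verts G)"
  shows "\<exists>S. independent_set G S \<and> card S = independence_number G"
    and "independent_set G S \<Longrightarrow> card S \<le> independence_number G"
proof -
  have "{card S | S. independent_set G S} \<subseteq> card ` Pow (verts G)"
    by (auto simp: independent_set_def)
  then have fin: "finite {card S | S. independent_set G S}"
    using assms finite_subset by blast
  have "independent_set G {}" by (simp add: independent_set_def)
  then have "{card S | S. independent_set G S} \<noteq> {}" by blast
  then have "independence_number G \<in> {card S | S. independent_set G S}"
    unfolding independence_number_def using fin by (rule Max_in[rotated])
  then show "\<exists>S. independent_set G S \<and> card S = independence_number G" by force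
  show "independent_set G S \<Longrightarrow> card S \<le> independence_number G"
    unfolding independence_number_def using fin by (intro Max_ge) auto
qed

lemma stable_relation_of_graph:
  assumes G: "graph G" and stable: "k0_stable 3 G" and n: "3 \<le> card (verts G)"
  shows "stable_relation (verts G) (arcs_ends G) (independence_number G)"
proof -
  interpret graph G by fact
  have eq: "indep (verts G) (arcs_ends G) S \<longleftrightarrow> independent_set G S" for S
    by (simp add: indep_def independent_set_def)
  show ?thesis
  proof unfold_locales
    show "finite (verts G)" by simp
    show "arcs_ends G \<subseteq> verts G \<times> verts G" by (auto simp: arcs_ends_conv)
    show "(y, x) \<in> arcs_ends G" if "(x, y) \<in> arcs_ends G" for x y
      using that sym_arcs unfolding symmetric_def sym_def by blast
    show "(x, x) \<notin> arcs_ends G" for x using no_loops by (auto simp: arcs_ends_conv)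
    show "card S \<le> independence_number G" if "indep (verts G) (arcs_ends G) S" for S
      using that independence_number_props(2)[of G S] by (simp add: eq)
    fix D assume D: "D \<subseteq> verts G" "card D \<le> 3"
    obtain W where W: "D \<subseteq> W" "W \<subseteq> verts G" "card W = 3"
      using exists_subset_between[OF D(2) n D(1)] by auto
    let ?H = "G \<restriction> (verts G - W)"
    have "finite (verts ?H)" by (simp add: induce_subgraph_verts)
    then obtain S where S: "independent_set ?H S" "card S = independence_number ?H"
      using independence_number_props(1) by blast
    have sub: "S \<subseteq> verts G - W" using S(1) by (simp add: independent_set_def induce_subgraph_verts)
    have "(x, y) \<notin> arcs_ends G" if "x \<in> S" "y \<in> S" for x y
    proof
      assume "(x, y) \<in> arcs_ends G"
      then obtain e where "e \<in> arcs G" "tail G e = x" "head G e = y"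
        by (auto simp: arcs_ends_conv)
      then have "e \<in> arcs ?H" "tail ?H e = x" "head ?H e = y"
        using that sub by (auto simp: induce_subgraph_def)
      then have "(x, y) \<in> arcs_ends ?H" by (auto simp: arcs_ends_conv)
      then show False using S(1) that by (simp add: independent_set_def)
    qed
    then have "independent_set G S" using sub by (auto simp: independent_set_def)
    moreover have "independence_number G \<le> card S"
      using stable W(2,3) S(2) unfolding k0_stable_def by auto
    ultimately show "\<exists>S. indep (verts G) (arcs_ends G) S \<and> card S = independence_number G \<and> S \<inter> D = {}"
      using independence_number_props(2)[of G S] sub W(1) eq by (intro exI[of _ S]) auto
  qed
qed

theorem theorem1p3:
  fixes G :: "('a, 'b) pre_digraph"
  assumes "graph G"
    and "tight_k0_stable 3 G"
  shows "\<exists>H. spanning H G \<and>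
    (digraph_iso H (complete_graph 4) \<or> digraph_iso H (complete_graph 5) \<or>
     digraph_iso H graph_H7 \<or> digraph_iso H graph_H9 \<or> digraph_iso H graph_T9)"
proof -
  interpret graph G by fact
  define \<alpha> where "\<alpha> = independence_number G"
  have stable: "k0_stable 3 G" and "int \<alpha> = (int (card (verts G)) - 2) div 2"
    using assms(2) by (auto simp: tight_k0_stable_def \<alpha>_def)
  then have n: "card (verts G) = 2 * \<alpha> + 2 \<or> card (verts G) = 2 * \<alpha> + 3" by presburger
  then obtain x where "x \<in> verts G" by fastforce
  then have "independent_set G {x}"
    using no_loops by (auto simp: independent_set_def arcs_ends_conv)
  then have "1 \<le> \<alpha>" using independence_number_props(2)[of G "{x}"] by (simp add: \<alpha>_def)
  then have "3 \<le> card (verts G)" using n by linarith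
  then interpret stable_relation "verts G" "arcs_ends G" \<alpha>
    unfolding \<alpha>_def by (rule stable_relation_of_graph[OF assms(1) stable])
  obtain E where E: "E \<subseteq> arcs_ends G" and crit: "critical_stable_relation (verts G) E \<alpha>"
    using ex_critical by blast
  interpret C: critical_stable_relation "verts G" E \<alpha> by fact
  note copy = spanning_copy[OF assms(1) _ E]
  from n show ?thesis
  proof
    assume n: "card (verts G) = 2 * \<alpha> + 2"
    then have "\<alpha> = 1" using C.even_order \<open>1 \<le> \<alpha>\<close> by simp
    then have "hosts (verts G) E (complete_graph 4)" using C.hosts_complete[of 4] n by simp
    then have "\<exists>H. spanning H G \<and> digraph_iso H (complete_graph 4)"
      unfolding complete_graph_def by (rule copy) auto
    then show ?thesis by blast
  next
    assume n: "card (verts G) = 2 * \<alpha> + 3"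
    then obtain v where v: "4 \<le> card (E `` {v})" using C.ex_degree_ge_4 by auto
    obtain I where I: "\<And>u. (v, u) \<in> E \<Longrightarrow> edge_witness (verts G) E \<alpha> v u (I u)"
      using C.critical by metis
    interpret hub "verts G" E \<alpha> v I
      by unfold_locales (use n v I in auto)
    from hosts_odd show ?thesis
    proof (elim disjE)
      assume "hosts (verts G) E (complete_graph 5)"
      then have "\<exists>H. spanning H G \<and> digraph_iso H (complete_graph 5)"
        unfolding complete_graph_def by (rule copy) auto
      then show ?thesis by blast
    next
      assume "hosts (verts G) E graph_H7"
      then have "\<exists>H. spanning H G \<and> digraph_iso H graph_H7"
        unfolding graph_H7_def by (rule copy) auto
      then show ?thesis by blast
    next
      assume "hosts (verts G) E graph_H9"
      then have "\<exists>H. spanning H G \<and> digraph_iso H graph_H9"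
        unfolding graph_H9_def by (rule copy) auto
      then show ?thesis by blast
    next
      assume "hosts (verts G) E graph_T9"
      then have "\<exists>H. spanning H G \<and> digraph_iso H graph_T9"
        unfolding graph_T9_def by (rule copy) auto
      then show ?thesis by blast
    qed
  qed
qed

end
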